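(* Let $X$ be a normed linear space, $E\subset X$, and let $f$ be a real function on $E$. Consider the following statements: (i) $f$ can be extended to a function $F\in C^{1,+}(X)$. (ii) There exists $G\colon E\to X^*$ such that $f$ satisfies condition $(\mathrm W_G)$ and for each $d>0$ there exists $K>0$ such that $$\|G(y)-G(x)\|\le K\|y-x\|,$$ $$|f(y)-f(x)-\langle G(x),y-x\rangle|\le K\|y-x\|^2$$ whenever $x,y\in E$, $\|y-x\|\ge d$. Then (i)$\Rightarrow$(ii). If $X$ is a super-reflexive Banach space that has an equivalent norm with modulus of smoothness of power type $2$, then both statements are equivalent, and moreover if (ii) holds with a mapping $G$, then $F$ can be found such that $DF(x)=G(x)$ for each $x\in E$.
   Context: All normed linear spaces are real; $\langle g,x\rangle=g(x)$ for $g\in X^*$, $x\in X$, and $DF$ denotes the Fréchet derivative of $F$. For an open subset $U$ of a normed linear space, $C^{1,+}(U)$ is the set of all Fréchet differentiable $f\colon U\to\mathbb R$ such that $Df$ is uniformly continuous on $U$. For $E\subset X$, $f\colon E\to\mathbb R$ and $G\colon E\to X^*$, we say that $f$ satisfies condition $(\mathrm W_G)$ if $G$ is uniformly continuous and for each $\varepsilon>0$ there exists $\delta>0$ such that $|f(y)-f(x)-\langle G(x),y-x\rangle|\le\varepsilon\|y-x\|$ whenever $x,y\in E$ and $\|y-x\|<\delta$. The modulus of smoothness of a norm $\|\cdot\|$ on $X$ is $\rho(\tau)=\sup\{\frac{\|x+\tau y\|+\|x-\tau y\|}{2}-1 : x,y\in X,\ \|x\|=\|y\|=1\}$, $\tau\ge0$;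 it is of power type $p>1$ if there is $K>0$ with $\rho(\tau)\le K\tau^p$ for all $\tau\ge0$. A Banach space is super-reflexive if and only if it has an equivalent uniformly smooth norm. *)

theory Defs
  imports "HOL-Analysis.Analysis"
begin

definition frechet_D :: "('a::real_normed_vector \<Rightarrow> real) \<Rightarrow> 'a \<Rightarrow> ('a \<Rightarrow>\<^sub>L real)" where
  "frechet_D f x = Blinfun (frechet_derivative f (at x))"

text \<open>A function on \<open>U\<close> is a total function of which only the values on \<open>U\<close> matter;
  the definition is meant for open \<open>U\<close>.\<close>

definition C1_plus :: "'a::real_normed_vector set \<Rightarrow> ('a \<Rightarrow> real) set" where
  "C1_plus U = {f. (\<forall>x\<in>U. f differentiable (at x)) \<and> uniformly_continuous_on U (frechet_D f)}"

definition cond_W ::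
  "'a::real_normed_vector set \<Rightarrow> ('a \<Rightarrow> real) \<Rightarrow> ('a \<Rightarrow> ('a \<Rightarrow>\<^sub>L real)) \<Rightarrow> bool" where
  "cond_W E f G \<longleftrightarrow>
     uniformly_continuous_on E G \<and>
     (\<forall>\<epsilon>>0. \<exists>\<delta>>0. \<forall>x\<in>E. \<forall>y\<in>E. norm (y - x) < \<delta> \<longrightarrow>
        \<bar>f y - f x - blinfun_apply (G x) (y - x)\<bar> \<le> \<epsilon> * norm (y - x))"

definition cond_large ::
  "'a::real_normed_vector set \<Rightarrow> ('a \<Rightarrow> real) \<Rightarrow> ('a \<Rightarrow> ('a \<Rightarrow>\<^sub>L real)) \<Rightarrow> bool" where
  "cond_large E f G \<longleftrightarrow>
     (\<forall>d>0. \<exists>K>0. \<forall>x\<in>E. \<forall>y\<in>E. norm (y - x) \<ge> d \<longrightarrow>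
        norm (G y - G x) \<le> K * norm (y - x) \<and>
        \<bar>f y - f x - blinfun_apply (G x) (y - x)\<bar> \<le> K * (norm (y - x))\<^sup>2)"

definition equivalent_norm :: "('a::real_normed_vector \<Rightarrow> real) \<Rightarrow> bool" where
  "equivalent_norm N \<longleftrightarrow>
     (\<forall>x. N x = 0 \<longleftrightarrow> x = 0) \<and>
     (\<forall>x y. N (x + y) \<le> N x + N y) \<and>
     (\<forall>c x. N (c *\<^sub>R x) = \<bar>c\<bar> * N x) \<and>
     (\<exists>a>0. \<exists>b>0. \<forall>x. a * norm x \<le> N x \<and> N x \<le> b * norm x)"

text \<open>The supremum is over nonnegative numbers, by convexity of the norm. The extra element 0
  thus changes nothing, except that it makes the modulus 0 on the trivial space,
  where the unit sphere is empty.\<close>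

definition modulus_of_smoothness :: "('a::real_normed_vector \<Rightarrow> real) \<Rightarrow> real \<Rightarrow> real" where
  "modulus_of_smoothness N \<tau> =
     Sup (insert 0 {(N (x + \<tau> *\<^sub>R y) + N (x - \<tau> *\<^sub>R y)) / 2 - 1 | x y. N x = 1 \<and> N y = 1})"

definition smoothness_power_type :: "('a::real_normed_vector \<Rightarrow> real) \<Rightarrow> real \<Rightarrow> bool" where
  "smoothness_power_type N p \<longleftrightarrow>
     p > 1 \<and> (\<exists>K>0. \<forall>\<tau>\<ge>0. modulus_of_smoothness N \<tau> \<le> K * \<tau> powr p)"

definition uniformly_smooth :: "('a::real_normed_vector \<Rightarrow> real) \<Rightarrow> bool" where
  "uniformly_smooth N \<longleftrightarrow> ((\<lambda>\<tau>. modulus_of_smoothness N \<tau> / \<tau>) \<longlongrightarrow> 0) (at_right 0)"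

text \<open>Super-reflexivity quantifies over all Banach spaces finitely representable in the given one,
  which is not possible inside a formula. We use Enflo's description: for a Banach space,
  super-reflexive means having an equivalent uniformly smooth norm.\<close>

definition super_reflexive :: "'a::real_normed_vector itself \<Rightarrow> bool" where
  "super_reflexive _ \<longleftrightarrow>
     complete (UNIV :: 'a set) \<and>
     (\<exists>N :: 'a \<Rightarrow> real. equivalent_norm N \<and> uniformly_smooth N)"

end

theory Submission
  imports Defs
begin

text \<open>
  That an extension forces both conditions on \<open>G = DF\<close> is the mean value inequality, together with the
  fact that a uniformly continuous map on a normed space grows at most linearly at large distances.

  For the converse, the two conditions together say that for each \<open>e > 0\<close> there is \<open>M e > 0\<close> with
  \<open>\<parallel>G y - G x\<parallel> \<le> e + M e * r\<close> and a first-order remainder at most \<open>(e + M e * r) * r\<close>, where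
  \<open>r\<close> is the distance of \<open>x\<close> and \<open>y\<close> (lemma \<open>cond_W_cond_large_affine_bound\<close>). In both bounds
  one may replace \<open>e + M e * r\<close> by \<open>\<omega> r\<close>, where \<open>\<omega>\<close> is the infimum of these affine functions: a
  concave modulus that tends to 0 at 0. All distances are measured by a norm \<open>N\<close> of power type 2.

  Put \<open>\<psi> h = N h * \<omega> (N h)\<close>. Each \<open>y \<in> E\<close> gives two functions
  \<open>f y + G y (x - y) \<plusminus> 6 * \<psi> (x - y)\<close> of \<open>x\<close>, which touch at \<open>y\<close>; the bounds on the data say
  that each lower function lies below each upper one, also for different points of \<open>E\<close>
  (\<open>jet_minorant_le_majorant\<close>). It remains to find a function of class \<open>C\<^sup>1\<^sup>,\<^sup>+\<close> between the two
  families. It then has the required values and derivatives on \<open>E\<close>.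

  Call a function paraconvex with defect \<open>p\<close> if it violates convexity on a segment from \<open>x\<close> to
  \<open>y\<close> by at most \<open>t * (1 - t) * p (x - y)\<close>. Power type 2 means that the squared norm is paraconcave with
  quadratic defect (\<open>norm_square_paraconcave\<close>), and this implies that \<open>\<psi>\<close> is paraconcave with
  defect a multiple of \<open>\<psi>\<close> itself (\<open>scaled_modulus_norm_paraconcave\<close>). Hence the lower functions are
  paraconvex and the upper ones paraconcave. The largest paraconvex function \<open>F\<close> below the upper family
  is then paraconcave too (\<open>paraconvex_insertion\<close>). A locally bounded function that is both,
  with defect \<open>o(\<parallel>h\<parallel>)\<close>, is almost affine on short segments, uniformly in space; so it is differentiable with uniformly
  continuous derivative (\<open>paraconvex_paraconcave_C1_plus\<close>).
\<close>

section \<open>Paraconvex functions and insertion\<close>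

text \<open>The allowed defect carries the weight \<open>t * (1 - t)\<close>, which vanishes at both ends of a
  segment, and not only a bound at midpoints. A midpoint bound \<open>p h = o(\<parallel>h\<parallel>)\<close> on both sides
  describes Zygmund smoothness, which does not imply differentiability; the weighted form
  compares difference quotients at different scales, and this makes them converge.\<close>

definition paraconvex :: "('a::real_vector \<Rightarrow> real) \<Rightarrow> ('a \<Rightarrow> real) \<Rightarrow> bool" where
  "paraconvex p w \<longleftrightarrow>
     (\<forall>x y. \<forall>t\<in>{0..1}.
        w (t *\<^sub>R x + (1 - t) *\<^sub>R y) \<le> t * w x + (1 - t) * w y + t * (1 - t) * p (x - y))"

abbreviation paraconcave :: "('a::real_vector \<Rightarrow> real) \<Rightarrow> ('a \<Rightarrow> real) \<Rightarrow> bool" where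
  "paraconcave p w \<equiv> paraconvex p (\<lambda>x. - w x)"

lemma paraconvexD:
  assumes "paraconvex p w" "0 \<le> t" "t \<le> 1"
  shows "w (t *\<^sub>R x + (1 - t) *\<^sub>R y) \<le> t * w x + (1 - t) * w y + t * (1 - t) * p (x - y)"
  using assms by (auto simp: paraconvex_def)

lemma paraconvex_shifted_average:
  assumes F: "paraconvex p F" and t: "0 \<le> t" "t \<le> 1"
  shows "paraconvex p (\<lambda>x. t * F (x + a) + (1 - t) * F (x + b) - c)"
  unfolding paraconvex_def
proof (intro allI ballI)
  fix x y :: 'a and s :: real
  assume s: "s \<in> {0..1}"
  have shift: "F (s *\<^sub>R x + (1 - s) *\<^sub>R y + d)
      \<le> s * F (x + d) + (1 - s) * F (y + d) + s * (1 - s) * p (x - y)" for d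
    using paraconvexD[OF F, of s "x + d" "y + d"] s by (simp add: algebra_simps)
  have "t * F (s *\<^sub>R x + (1 - s) *\<^sub>R y + a)
      \<le> t * (s * F (x + a) + (1 - s) * F (y + a) + s * (1 - s) * p (x - y))"
    by (rule mult_left_mono[OF shift t(1)])
  moreover have "(1 - t) * F (s *\<^sub>R x + (1 - s) *\<^sub>R y + b)
      \<le> (1 - t) * (s * F (x + b) + (1 - s) * F (y + b) + s * (1 - s) * p (x - y))"
    by (rule mult_left_mono[OF shift]) (use t in simp)
  ultimately show "t * F (s *\<^sub>R x + (1 - s) *\<^sub>R y + a) + (1 - t) * F (s *\<^sub>R x + (1 - s) *\<^sub>R y + b) - c
      \<le> s * (t * F (x + a) + (1 - t) * F (x + b) - c)
        + (1 - s) * (t * F (y + a) + (1 - t) * F (y + b) - c) + s * (1 - s) * p (x - y)"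
    by (simp add: algebra_simps)
qed

text \<open>For a fixed \<open>p\<close> the class of paraconvex functions is cut out by inequalities that bound a value
  from above by nonnegative multiples of other values, and such inequalities survive suprema.\<close>

lemma paraconvex_Sup:
  assumes S: "S \<noteq> {}" and cvx: "\<And>w. w \<in> S \<Longrightarrow> paraconvex p w"
    and bdd: "\<And>x. bdd_above ((\<lambda>w. w x) ` S)"
  shows "paraconvex p (\<lambda>x. SUP w\<in>S. w x)"
  unfolding paraconvex_def
proof (intro allI ballI cSUP_least[OF S])
  fix x y :: 'a and t :: real and w
  assume t: "t \<in> {0..1}" and w: "w \<in> S"
  have "w (t *\<^sub>R x + (1 - t) *\<^sub>R y) \<le> t * w x + (1 - t) * w y + t * (1 - t) * p (x - y)"
    using paraconvexD[OF cvx[OF w]] t by simp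
  moreover have "t * w x \<le> t * (SUP w\<in>S. w x)" "(1 - t) * w y \<le> (1 - t) * (SUP w\<in>S. w y)"
    using t by (auto intro!: mult_left_mono cSUP_upper[OF w bdd])
  ultimately show "w (t *\<^sub>R x + (1 - t) *\<^sub>R y)
      \<le> t * (SUP w\<in>S. w x) + (1 - t) * (SUP w\<in>S. w y) + t * (1 - t) * p (x - y)"
    by linarith
qed

text \<open>A form of Ilmanen's lemma. \<open>F\<close> is the largest paraconvex function below \<open>B\<close>, and maximality
  makes it paraconcave: an average of two translates of \<open>F\<close>, lowered by the defect that \<open>B\<close>
  admits, is again paraconvex and below \<open>B\<close>, hence below \<open>F\<close>.\<close>

lemma paraconvex_insertion:
  assumes ne: "A \<noteq> {}" "B \<noteq> {}"
    and A: "\<And>a. a \<in> A \<Longrightarrow> paraconvex p a"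
    and B: "\<And>b. b \<in> B \<Longrightarrow> paraconcave p b"
    and AB: "\<And>a b x. a \<in> A \<Longrightarrow> b \<in> B \<Longrightarrow> a x \<le> b x"
  obtains F where "paraconvex p F" "paraconcave p F"
    "\<And>a x. a \<in> A \<Longrightarrow> a x \<le> F x" "\<And>b x. b \<in> B \<Longrightarrow> F x \<le> b x"
proof
  define S where "S = {w. paraconvex p w \<and> (\<forall>b\<in>B. \<forall>x. w x \<le> b x)}"
  define F where "F = (\<lambda>x. SUP w\<in>S. w x)"
  have AS: "A \<subseteq> S"
    using A AB by (auto simp: S_def)
  then have S_ne: "S \<noteq> {}"
    using ne by auto
  obtain b0 where b0: "b0 \<in> B"
    using ne by auto
  have bdd: "bdd_above ((\<lambda>w. w x) ` S)" for x
    using b0 by (auto simp: S_def bdd_above_def)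
  have upper: "w x \<le> F x" if "w \<in> S" for w x
    unfolding F_def by (rule cSUP_upper[OF that bdd])
  show FB: "F x \<le> b x" if "b \<in> B" for b x
    unfolding F_def by (rule cSUP_least[OF S_ne]) (use that in \<open>auto simp: S_def\<close>)
  show "a x \<le> F x" if "a \<in> A" for a x
    using upper AS that by blast
  show F: "paraconvex p F"
    unfolding F_def by (rule paraconvex_Sup[OF S_ne _ bdd]) (simp add: S_def)
  show "paraconcave p F"
    unfolding paraconvex_def
  proof (intro allI ballI)
    fix x y :: 'a and t :: real
    assume t: "t \<in> {0..1}"
    \<comment> \<open>The translations are chosen so that the end points for \<open>z = t *\<^sub>R x + (1 - t) *\<^sub>R y\<close> are \<open>x\<close> and \<open>y\<close>.\<close>
    define w where "w = (\<lambda>z. t * F (z + (1 - t) *\<^sub>R (x - y)) + (1 - t) * F (z + (- t) *\<^sub>R (x - y))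
      - t * (1 - t) * p (x - y))"
    have "w \<in> S"
      unfolding S_def
    proof (intro CollectI conjI ballI allI)
      show "paraconvex p w"
        unfolding w_def by (rule paraconvex_shifted_average[OF F]) (use t in auto)
      fix b z
      assume b: "b \<in> B"
      have ends: "t *\<^sub>R (z + (1 - t) *\<^sub>R (x - y)) + (1 - t) *\<^sub>R (z + (- t) *\<^sub>R (x - y)) = z"
        "(z + (1 - t) *\<^sub>R (x - y)) - (z + (- t) *\<^sub>R (x - y)) = x - y"
        by (simp_all add: algebra_simps)
      have "t * F (z + (1 - t) *\<^sub>R (x - y)) \<le> t * b (z + (1 - t) *\<^sub>R (x - y))"
        "(1 - t) * F (z + (- t) *\<^sub>R (x - y)) \<le> (1 - t) * b (z + (- t) *\<^sub>R (x - y))"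
        using t by (auto intro!: mult_left_mono FB[OF b])
      moreover have "- b z \<le> t * - b (z + (1 - t) *\<^sub>R (x - y)) + (1 - t) * - b (z + (- t) *\<^sub>R (x - y))
          + t * (1 - t) * p (x - y)"
        using paraconvexD[OF B[OF b], of t "z + (1 - t) *\<^sub>R (x - y)" "z + (- t) *\<^sub>R (x - y)"] t
        unfolding ends by simp
      ultimately show "w z \<le> b z"
        unfolding w_def by simp
    qed
    from upper[OF this, of "t *\<^sub>R x + (1 - t) *\<^sub>R y"]
    have "w (t *\<^sub>R x + (1 - t) *\<^sub>R y) \<le> F (t *\<^sub>R x + (1 - t) *\<^sub>R y)" .
    moreover have "t *\<^sub>R x + (1 - t) *\<^sub>R y + (1 - t) *\<^sub>R (x - y) = x"
      "t *\<^sub>R x + (1 - t) *\<^sub>R y + (- t) *\<^sub>R (x - y) = y"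
      by (simp_all add: algebra_simps)
    ultimately show "- F (t *\<^sub>R x + (1 - t) *\<^sub>R y)
        \<le> t * - F x + (1 - t) * - F y + t * (1 - t) * p (x - y)"
      by (simp add: w_def)
  qed
qed

section \<open>Differentiability of functions that are paraconvex and paraconcave\<close>

lemma has_derivative_if_little_o:
  fixes F :: "'a::real_normed_vector \<Rightarrow> real"
  assumes "bounded_linear L"
    and "\<And>e. 0 < e \<Longrightarrow> \<exists>d>0. \<forall>h. norm h < d \<longrightarrow> \<bar>F (x + h) - F x - L h\<bar> \<le> e * norm h"
  shows "(F has_derivative L) (at x)"
  unfolding has_derivative_at_alt
proof (intro conjI allI impI assms(1))
  fix e :: real
  assume "0 < e"
  then obtain d where d: "d > 0" "\<And>h. norm h < d \<Longrightarrow> \<bar>F (x + h) - F x - L h\<bar> \<le> e * norm h"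
    using assms(2) by blast
  show "\<exists>d>0. \<forall>y. norm (y - x) < d \<longrightarrow> norm (F y - F x - L (y - x)) \<le> e * norm (y - x)"
    using d(2)[of "_ - x"] d(1) by auto
qed

lemma blinfun_apply_frechet_D:
  assumes "(F has_derivative L) (at x)"
  shows "blinfun_apply (frechet_D F x) = L"
  using assms frechet_derivative_at[OF assms] has_derivative_bounded_linear[OF assms]
  by (simp add: frechet_D_def bounded_linear_Blinfun_apply)

lemma little_o_along_ray:
  fixes p :: "'a::real_normed_vector \<Rightarrow> real"
  assumes small: "\<And>e. 0 < e \<Longrightarrow> \<exists>d>0. \<forall>h. norm h < d \<longrightarrow> p h \<le> e * norm h"
    and e: "0 < e"
  shows "\<exists>d>0. \<forall>s. 0 < s \<and> s < d \<longrightarrow> p (s *\<^sub>R h) / s \<le> e"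
proof -
  obtain d where d: "d > 0" "\<And>k. norm k < d \<Longrightarrow> p k \<le> e / (norm h + 1) * norm k"
    using small[of "e / (norm h + 1)"] e by (auto simp: add_nonneg_pos)
  have pos: "norm h + 1 > 0"
    by (simp add: add_nonneg_pos)
  have "p (s *\<^sub>R h) / s \<le> e" if s: "0 < s" "s < d / (norm h + 1)" for s
  proof -
    have "s * (norm h + 1) < d"
      using s pos by (simp add: field_simps)
    then have "s * norm h < d"
      using s by (simp add: distrib_left)
    then have "p (s *\<^sub>R h) \<le> e / (norm h + 1) * (s * norm h)"
      using d(2)[of "s *\<^sub>R h"] s by simp
    also have "\<dots> = s * (e * (norm h / (norm h + 1)))"
      by simp
    also have "\<dots> \<le> s * (e * 1)"
      using s e pos by (intro mult_left_mono) auto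
    finally show ?thesis
      using s by (simp add: field_simps)
  qed
  then show ?thesis
    using d(1) pos by (intro exI[of _ "d / (norm h + 1)"]) auto
qed

text \<open>The hypothesis compares the difference quotients at the scales \<open>t\<close> and \<open>1\<close> in direction \<open>h\<close>.
  Applied to \<open>s *\<^sub>R h\<close> it bounds the distance of the quotients at scales \<open>r \<le> s\<close> by
  \<open>p (s *\<^sub>R h) / s\<close>, which tends to 0, so the quotients form a Cauchy family.\<close>

lemma directional_derivative_if_chords:
  fixes F :: "'a::real_normed_vector \<Rightarrow> real"
  assumes chord: "\<And>h t. 0 \<le> t \<Longrightarrow> t \<le> 1 \<Longrightarrow>
      \<bar>F (x + t *\<^sub>R h) - F x - t * (F (x + h) - F x)\<bar> \<le> t * p h"
    and small: "\<And>e. 0 < e \<Longrightarrow> \<exists>d>0. \<forall>h. norm h < d \<longrightarrow> p h \<le> e * norm h"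
  obtains l where "((\<lambda>s. (F (x + s *\<^sub>R h) - F x) / s) \<longlongrightarrow> l) (at_right 0)"
    "\<bar>F (x + h) - F x - l\<bar> \<le> p h"
proof -
  define q where "q = (\<lambda>s. (F (x + s *\<^sub>R h) - F x) / s)"
  have q_diff: "\<bar>q r - q s\<bar> \<le> p (s *\<^sub>R h) / s" if "0 < r" "r \<le> s" for r s
  proof -
    have "\<bar>F (x + (r / s) *\<^sub>R (s *\<^sub>R h)) - F x - (r / s) * (F (x + s *\<^sub>R h) - F x)\<bar>
        \<le> (r / s) * p (s *\<^sub>R h)"
      by (rule chord) (use that in auto)
    moreover have "r * (q r - q s) = F (x + r *\<^sub>R h) - F x - (r / s) * (F (x + s *\<^sub>R h) - F x)"
      using that by (simp add: q_def field_simps)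
    ultimately have "r * \<bar>q r - q s\<bar> \<le> r * (p (s *\<^sub>R h) / s)"
      using that by (simp add: abs_mult flip: abs_mult_pos')
    then show ?thesis
      using that by (simp only: mult_le_cancel_left_pos)
  qed
  define X where "X = (\<lambda>n. q (inverse (real (Suc n))))"
  have inv: "(\<lambda>n. inverse (real (Suc n))) \<longlonglongrightarrow> 0"
    by (rule LIMSEQ_inverse_real_of_nat)
  have "Cauchy X"
  proof (rule CauchyI')
    fix e :: real
    assume e: "0 < e"
    obtain d where d: "d > 0" "\<And>s. 0 < s \<Longrightarrow> s < d \<Longrightarrow> p (s *\<^sub>R h) / s \<le> e / 2"
      using little_o_along_ray[OF small, of "e / 2" h] e by auto
    obtain n0 where n0: "\<And>n. n \<ge> n0 \<Longrightarrow> inverse (real (Suc n)) < d"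
      using order_tendstoD(2)[OF inv d(1)] by (auto simp: eventually_sequentially)
    have "dist (X m) (X n) < e" if mn: "m \<ge> n0" "n > m" for m n
    proof -
      have "\<bar>X n - X m\<bar> \<le> p (inverse (real (Suc m)) *\<^sub>R h) / inverse (real (Suc m))"
        unfolding X_def by (rule q_diff) (use mn in \<open>auto simp: field_simps\<close>)
      also have "\<dots> \<le> e / 2"
        by (rule d(2)) (use n0 mn in auto)
      finally show ?thesis
        using e unfolding dist_real_def by linarith
    qed
    then show "\<exists>M. \<forall>m\<ge>M. \<forall>n>m. dist (X m) (X n) < e"
      by blast
  qed
  then obtain l where l: "X \<longlonglongrightarrow> l"
    using convergent_eq_Cauchy[of X] by auto
  have q_l: "\<bar>q s - l\<bar> \<le> p (s *\<^sub>R h) / s" if s: "0 < s" for s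
  proof (rule tendsto_upperbound)
    show "(\<lambda>n. \<bar>q s - X n\<bar>) \<longlonglongrightarrow> \<bar>q s - l\<bar>"
      by (intro tendsto_intros l)
    show "\<forall>\<^sub>F n in sequentially. \<bar>q s - X n\<bar> \<le> p (s *\<^sub>R h) / s"
      using order_tendstoD(2)[OF inv s]
    proof eventually_elim
      case (elim n)
      then show ?case
        using q_diff[of "inverse (real (Suc n))" s] by (simp add: X_def abs_minus_commute)
    qed
  qed simp
  have "(q \<longlongrightarrow> l) (at_right 0)"
  proof (rule tendstoI)
    fix e :: real
    assume e: "0 < e"
    obtain d where d: "d > 0" "\<And>s. 0 < s \<Longrightarrow> s < d \<Longrightarrow> p (s *\<^sub>R h) / s \<le> e / 2"
      using little_o_along_ray[OF small, of "e / 2" h] e by auto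
    have "dist (q s) l < e" if "0 < s" "s < d" for s
      using q_l[of s] d(2)[OF that] that e unfolding dist_real_def by linarith
    then show "\<forall>\<^sub>F s in at_right 0. dist (q s) l < e"
      using d(1) by (auto simp: eventually_at_right_field)
  qed
  moreover have "\<bar>F (x + h) - F x - l\<bar> \<le> p h"
    using q_l[of 1] by (simp add: q_def)
  ultimately show ?thesis
    using that by (auto simp: q_def)
qed

text \<open>The directional derivative is additive since paraconvexity and paraconcavity compare the value
  at the midpoint of \<open>x + s *\<^sub>R h\<close> and \<open>x + s *\<^sub>R k\<close> with the mean of the values up to
  \<open>o(s)\<close>. It is bounded since \<open>F\<close> is bounded near \<open>x\<close>; that hypothesis is needed because
  discontinuous linear functionals are both paraconvex and paraconcave.\<close>

lemma paraconvex_paraconcave_has_derivative: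
  fixes F :: "'a::real_normed_vector \<Rightarrow> real"
  assumes cvx: "paraconvex p F" and ccv: "paraconcave p F"
    and small: "\<And>e. 0 < e \<Longrightarrow> \<exists>d>0. \<forall>h. norm h < d \<longrightarrow> p h \<le> e * norm h"
    and bnd: "\<exists>r>0. \<exists>b. \<forall>h. norm h < r \<longrightarrow> \<bar>F (x + h)\<bar> \<le> b"
  obtains L where "(F has_derivative L) (at x)" "\<And>h. \<bar>F (x + h) - F x - L h\<bar> \<le> p h"
proof -
  \<comment> \<open>\<open>F\<close> is almost affine on each segment.\<close>
  have two_sided: "\<bar>F (t *\<^sub>R y + (1 - t) *\<^sub>R z) - t * F y - (1 - t) * F z\<bar> \<le> t * (1 - t) * p (y - z)"
    if "0 \<le> t" "t \<le> 1" for t y z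
    using paraconvexD[OF cvx, of t y z] paraconvexD[OF ccv, of t y z] that by (simp add: abs_le_iff)
  have p_nonneg: "p h \<ge> 0" for h
    using order_trans[OF abs_ge_zero two_sided[of "1/2" h 0]] by simp
  have chord: "\<bar>F (x + t *\<^sub>R h) - F x - t * (F (x + h) - F x)\<bar> \<le> t * p h"
    if t: "0 \<le> t" "t \<le> 1" for h t
  proof -
    have "t *\<^sub>R (x + h) + (1 - t) *\<^sub>R x = x + t *\<^sub>R h"
      by (simp add: algebra_simps)
    then have "\<bar>F (x + t *\<^sub>R h) - F x - t * (F (x + h) - F x)\<bar> \<le> t * (1 - t) * p h"
      using two_sided[OF t, of "x + h" x] by (simp add: algebra_simps)
    also have "\<dots> \<le> t * 1 * p h"
      using t p_nonneg by (intro mult_right_mono mult_left_mono) auto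
    finally show ?thesis by simp
  qed
  have "\<exists>L. \<forall>h. ((\<lambda>s. (F (x + s *\<^sub>R h) - F x) / s) \<longlongrightarrow> L h) (at_right 0) \<and>
      \<bar>F (x + h) - F x - L h\<bar> \<le> p h"
  proof (intro choice allI)
    fix h
    show "\<exists>l. ((\<lambda>s. (F (x + s *\<^sub>R h) - F x) / s) \<longlongrightarrow> l) (at_right 0) \<and>
        \<bar>F (x + h) - F x - l\<bar> \<le> p h"
      by (rule directional_derivative_if_chords[of F x p h, OF chord small]) blast+
  qed
  then obtain L where
    lim: "\<And>h. ((\<lambda>s. (F (x + s *\<^sub>R h) - F x) / s) \<longlongrightarrow> L h) (at_right 0)" and
    approx: "\<And>h. \<bar>F (x + h) - F x - L h\<bar> \<le> p h"
    by blast
  have uniq: "L h = l" if "((\<lambda>s. (F (x + s *\<^sub>R h) - F x) / s) \<longlongrightarrow> l) (at_right 0)" for h l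
    using tendsto_unique[OF _ lim that] by simp
  have L_pos: "L (c *\<^sub>R h) = c * L h" if c: "c > 0" for c h
  proof (rule uniq)
    have "filterlim (\<lambda>s. c * s) (at_right 0) (at_right 0)"
      by (rule filterlim_times_pos[OF filterlim_ident c]) simp
    then have "((\<lambda>s. (F (x + (c * s) *\<^sub>R h) - F x) / (c * s)) \<longlongrightarrow> L h) (at_right 0)"
      by (rule filterlim_compose[OF lim])
    from tendsto_mult_left[OF this, of c]
    show "((\<lambda>s. (F (x + s *\<^sub>R c *\<^sub>R h) - F x) / s) \<longlongrightarrow> c * L h) (at_right 0)"
      using c by (simp add: mult.commute)
  qed
  have p_lim: "((\<lambda>s. p (s *\<^sub>R k) / s) \<longlongrightarrow> 0) (at_right 0)" for k
  proof (rule tendstoI)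
    fix e :: real
    assume e: "0 < e"
    obtain d where d: "d > 0" "\<And>s. 0 < s \<Longrightarrow> s < d \<Longrightarrow> p (s *\<^sub>R k) / s \<le> e / 2"
      using little_o_along_ray[OF small, of "e / 2" k] e by auto
    have "dist (p (s *\<^sub>R k) / s) 0 < e" if "0 < s" "s < d" for s
    proof -
      have "0 \<le> p (s *\<^sub>R k) / s"
        using p_nonneg that by simp
      then show ?thesis
        using d(2)[OF that] e unfolding dist_real_def by linarith
    qed
    then show "\<forall>\<^sub>F s in at_right 0. dist (p (s *\<^sub>R k) / s) 0 < e"
      using d(1) by (auto simp: eventually_at_right_field)
  qed
  have L_mid: "L ((1/2) *\<^sub>R (h + k)) = (L h + L k) / 2" for h k
  proof (rule uniq)
    let ?q = "\<lambda>h s. (F (x + s *\<^sub>R h) - F x) / s"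
    have "((\<lambda>s. ?q ((1/2) *\<^sub>R (h + k)) s - (?q h s + ?q k s) / 2) \<longlongrightarrow> 0) (at_right 0)"
    proof (rule tendsto_0_le[OF p_lim[of "h - k"], where K = 1])
      show "\<forall>\<^sub>F s in at_right 0. norm (?q ((1/2) *\<^sub>R (h + k)) s - (?q h s + ?q k s) / 2)
          \<le> norm (p (s *\<^sub>R (h - k)) / s) * 1"
        unfolding eventually_at_right_field
      proof (intro exI[of _ 1] conjI allI impI)
        fix s :: real
        assume s: "0 < s"
        have mid: "(1/2) *\<^sub>R (x + s *\<^sub>R h) + (1 - 1/2) *\<^sub>R (x + s *\<^sub>R k) = x + s *\<^sub>R (1/2) *\<^sub>R (h + k)"
          by (simp add: scaleR_right_distrib) (simp add: algebra_simps flip: scaleR_left_distrib)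
        have diff: "(x + s *\<^sub>R h) - (x + s *\<^sub>R k) = s *\<^sub>R (h - k)"
          by (simp add: algebra_simps)
        have "\<bar>F (x + s *\<^sub>R (1/2) *\<^sub>R (h + k)) - (1/2) * F (x + s *\<^sub>R h) - (1 - 1/2) * F (x + s *\<^sub>R k)\<bar>
            \<le> 1/2 * (1 - 1/2) * p (s *\<^sub>R (h - k))"
          using two_sided[of "1/2" "x + s *\<^sub>R h" "x + s *\<^sub>R k"] unfolding mid diff by simp
        also have "\<dots> \<le> p (s *\<^sub>R (h - k))"
          using p_nonneg[of "s *\<^sub>R (h - k)"] by simp
        finally have mid_bound: "\<bar>F (x + s *\<^sub>R (1/2) *\<^sub>R (h + k)) - (1/2) * F (x + s *\<^sub>R h)
            - (1 - 1/2) * F (x + s *\<^sub>R k)\<bar> \<le> p (s *\<^sub>R (h - k))" .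
        have quotients: "a - 1/2 * b - (1 - 1/2) * d
            = s * ((a - c) / s - ((b - c) / s + (d - c) / s) / 2)" for a b c d :: real
          using s by (simp add: field_simps)
        have "\<bar>s * (?q ((1/2) *\<^sub>R (h + k)) s - (?q h s + ?q k s) / 2)\<bar> \<le> p (s *\<^sub>R (h - k))"
          using mid_bound unfolding quotients[where c = "F x"] .
        then show "norm (?q ((1/2) *\<^sub>R (h + k)) s - (?q h s + ?q k s) / 2)
            \<le> norm (p (s *\<^sub>R (h - k)) / s) * 1"
          using s p_nonneg by (simp add: abs_mult pos_le_divide_eq mult.commute)
      qed simp
    qed
    from tendsto_add[OF this tendsto_divide[OF tendsto_add[OF lim[of h] lim[of k]] tendsto_const[of 2]]]
    show "(?q ((1/2) *\<^sub>R (h + k)) \<longlongrightarrow> (L h + L k) / 2) (at_right 0)"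
      by simp
  qed
  have L_add: "L (h + k) = L h + L k" for h k
    using L_mid[of h k] L_pos[of "1/2" "h + k"] by simp
  have L_0: "L 0 = 0"
    by (rule uniq) simp
  have L_scale: "L (c *\<^sub>R h) = c * L h" for c h
  proof (cases c "0::real" rule: linorder_cases)
    case less
    have "L (c *\<^sub>R h) + L ((- c) *\<^sub>R h) = 0"
      using L_add[of "c *\<^sub>R h" "(- c) *\<^sub>R h"] L_0 by simp
    then show ?thesis
      using L_pos[of "- c" h] less by simp
  qed (auto simp: L_0 L_pos)
  obtain r b where r: "r > 0" and b: "\<And>h. norm h < r \<Longrightarrow> \<bar>F (x + h)\<bar> \<le> b"
    using bnd by blast
  obtain d where d: "d > 0" "\<And>h. norm h < d \<Longrightarrow> p h \<le> 1 * norm h"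
    using small[of 1] by auto
  define m where "m = min r d / 2"
  have m: "m > 0" "m < r" "m < d"
    using r d by (auto simp: m_def min_def)
  have L_ball: "\<bar>L h\<bar> \<le> 2 * b + m" if "norm h \<le> m" for h
  proof -
    have "\<bar>F (x + h)\<bar> \<le> b" "\<bar>F x\<bar> \<le> b" "p h \<le> m"
      using b[of h] b[of 0] d(2)[of h] r m that by auto
    then show ?thesis
      using approx[of h] by linarith
  qed
  have "bounded_linear L"
  proof (rule bounded_linear_intro[where K = "(2 * b + m) / m"])
    show "norm (L h) \<le> norm h * ((2 * b + m) / m)" for h
    proof (cases "h = 0")
      case False
      then have "\<bar>L ((m / norm h) *\<^sub>R h)\<bar> \<le> 2 * b + m"
        using m by (intro L_ball) simp
      then show ?thesis
        using m False by (simp add: L_scale abs_mult field_simps)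
    qed (simp add: L_0)
  qed (auto simp: L_add L_scale)
  moreover have "\<exists>d>0. \<forall>h. norm h < d \<longrightarrow> \<bar>F (x + h) - F x - L h\<bar> \<le> e * norm h" if "0 < e" for e
    using small[OF that] approx by (meson order_trans)
  ultimately have "(F has_derivative L) (at x)"
    by (rule has_derivative_if_little_o)
  then show ?thesis
    using that approx by blast
qed

text \<open>The first-order expansions around \<open>x\<close> and \<open>y\<close> describe the same increment \<open>F (y + h) - F y\<close>.
  With \<open>\<parallel>h\<parallel> = \<parallel>y - x\<parallel>\<close> this gives \<open>\<bar>L y h - L x h\<bar> = o(\<parallel>h\<parallel>)\<close>, uniformly in \<open>x\<close> and \<open>y\<close>.\<close>

lemma C1_plus_if_uniform_expansion:
  fixes F :: "'a::real_normed_vector \<Rightarrow> real"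
  assumes der: "\<And>x. (F has_derivative L x) (at x)"
    and approx: "\<And>x h. \<bar>F (x + h) - F x - L x h\<bar> \<le> p h"
    and small: "\<And>e. 0 < e \<Longrightarrow> \<exists>d>0. \<forall>h. norm h < d \<longrightarrow> p h \<le> e * norm h"
  shows "F \<in> C1_plus UNIV"
  unfolding C1_plus_def
proof (intro CollectI conjI ballI)
  show "F differentiable at x" for x
    using der differentiable_def by blast
  have D: "blinfun_apply (frechet_D F x) = L x" for x
    by (rule blinfun_apply_frechet_D[OF der])
  show "uniformly_continuous_on UNIV (frechet_D F)"
    unfolding uniformly_continuous_on_def
  proof (intro allI impI)
    fix e :: real
    assume e: "0 < e"
    obtain d where d: "d > 0" "\<And>h. norm h < d \<Longrightarrow> p h \<le> e / 5 * norm h"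
      using small[of "e / 5"] e by auto
    have "dist (frechet_D F y) (frechet_D F x) < e" if xy: "dist y x < d / 2" for x y
    proof (cases "y = x")
      case False
      define r where "r = norm (y - x)"
      have r: "r > 0" "2 * r < d"
        using False xy by (auto simp: r_def dist_norm)
      have "norm (frechet_D F y - frechet_D F x) \<le> 4 * e / 5"
      proof (rule norm_blinfun_bound)
        fix v
        show "norm (blinfun_apply (frechet_D F y - frechet_D F x) v) \<le> 4 * e / 5 * norm v"
        proof (cases "v = 0")
          case False
          \<comment> \<open>By homogeneity it is enough to test on vectors as long as \<open>y - x\<close>: there, all three
            increments \<open>h\<close>, \<open>y - x\<close> and \<open>y - x + h\<close> have comparable length.\<close>
          define h where "h = (r / norm v) *\<^sub>R v"
          have h: "norm h = r"
            using False r by (simp add: h_def)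
          have "r < d"
            using r by linarith
          then have p1: "p h \<le> e / 5 * r" "p (y - x) \<le> e / 5 * r"
            using d(2)[of h] d(2)[of "y - x"] h by (simp_all add: r_def)
          have n: "norm (y - x + h) \<le> 2 * r"
            using norm_triangle_ineq[of "y - x" h] h by (simp add: r_def)
          then have "p (y - x + h) \<le> e / 5 * norm (y - x + h)"
            using d(2) r by simp
          also have "\<dots> \<le> e / 5 * (2 * r)"
            using n e by (intro mult_left_mono) auto
          finally have p2: "p (y - x + h) \<le> e / 5 * (2 * r)" .
          have "L x (y - x + h) = L x (y - x) + L x h"
            using has_derivative_bounded_linear[OF der[of x]] by (simp add: linear_simps)
          then have "\<bar>L y h - L x h\<bar> \<le> p h + p (y - x) + p (y - x + h)"
            using approx[of y h] approx[of x "y - x"] approx[of x "y - x + h"]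
            by (simp add: add.assoc[symmetric] abs_le_iff)
          also have "\<dots> \<le> 4 * e / 5 * r"
            using p1 p2 by (simp add: field_simps)
          finally have "\<bar>blinfun_apply (frechet_D F y - frechet_D F x) h\<bar> \<le> 4 * e / 5 * r"
            by (simp add: blinfun.diff_left D)
          then have "(r / norm v) * \<bar>blinfun_apply (frechet_D F y - frechet_D F x) v\<bar> \<le> 4 * e / 5 * r"
            using r by (simp add: h_def blinfun.scaleR_right abs_mult)
          then show ?thesis
            using r False by (simp add: field_simps)
        qed simp
      qed (use e in simp)
      then show ?thesis
        using e by (simp add: dist_norm)
    qed (use e in simp)
    then show "\<exists>d>0. \<forall>x\<in>UNIV. \<forall>x'\<in>UNIV. dist x' x < d \<longrightarrow> dist (frechet_D F x') (frechet_D F x) < e"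
      using d(1) by (intro exI[of _ "d / 2"]) auto
  qed
qed

lemma paraconvex_paraconcave_C1_plus:
  fixes F :: "'a::real_normed_vector \<Rightarrow> real"
  assumes "paraconvex p F" "paraconcave p F"
    and small: "\<And>e. 0 < e \<Longrightarrow> \<exists>d>0. \<forall>h. norm h < d \<longrightarrow> p h \<le> e * norm h"
    and "\<And>x. \<exists>r>0. \<exists>b. \<forall>h. norm h < r \<longrightarrow> \<bar>F (x + h)\<bar> \<le> b"
  shows "F \<in> C1_plus UNIV"
proof -
  have "\<exists>L. (F has_derivative L) (at x) \<and> (\<forall>h. \<bar>F (x + h) - F x - L h\<bar> \<le> p h)" for x
    by (rule paraconvex_paraconcave_has_derivative[OF assms, of x]) auto
  then obtain L where "\<And>x. (F has_derivative L x) (at x)"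
    "\<And>x h. \<bar>F (x + h) - F x - L x h\<bar> \<le> p h"
    by metis
  from C1_plus_if_uniform_expansion[OF this small] show ?thesis .
qed

section \<open>Norms with modulus of smoothness of power type 2\<close>

lemma equivalent_norm_basic:
  assumes "equivalent_norm N"
  shows "N 0 = 0" "\<And>x. 0 \<le> N x" "\<And>x y. N (x + y) \<le> N x + N y"
    "\<And>c x. N (c *\<^sub>R x) = \<bar>c\<bar> * N x" "\<And>x y. N (x - y) = N (y - x)" "\<And>x. N x = 0 \<longleftrightarrow> x = 0"
proof -
  show "N 0 = 0" "\<And>x y. N (x + y) \<le> N x + N y" "\<And>x. N x = 0 \<longleftrightarrow> x = 0"
    and scale: "\<And>c x. N (c *\<^sub>R x) = \<bar>c\<bar> * N x"
    using assms by (auto simp: equivalent_norm_def)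
  obtain a where a: "a > 0" "\<And>x. a * norm x \<le> N x"
    using assms by (auto simp: equivalent_norm_def)
  show "0 \<le> N x" for x
    using a(2)[of x] a(1) by (meson mult_nonneg_nonneg norm_ge_zero order_trans less_imp_le)
  show "N (x - y) = N (y - x)" for x y
    using scale[of "-1" "x - y"] by simp
qed

lemma second_difference_le_modulus:
  assumes N: "equivalent_norm N" and tau: "0 \<le> \<tau>" and xy: "N x = 1" "N y = 1"
  shows "(N (x + \<tau> *\<^sub>R y) + N (x - \<tau> *\<^sub>R y)) / 2 - 1 \<le> modulus_of_smoothness N \<tau>"
  unfolding modulus_of_smoothness_def
proof (rule cSup_upper)
  show "bdd_above (insert 0
      {(N (x + \<tau> *\<^sub>R y) + N (x - \<tau> *\<^sub>R y)) / 2 - 1 | x y. N x = 1 \<and> N y = 1})"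
  proof (rule bdd_aboveI[of _ \<tau>])
    fix r
    assume "r \<in> insert 0
      {(N (x + \<tau> *\<^sub>R y) + N (x - \<tau> *\<^sub>R y)) / 2 - 1 | x y. N x = 1 \<and> N y = 1}"
    then consider "r = 0" | x y where "N x = 1" "N y = 1"
        "r = (N (x + \<tau> *\<^sub>R y) + N (x - \<tau> *\<^sub>R y)) / 2 - 1"
      by blast
    then show "r \<le> \<tau>"
    proof cases
      case (2 x y)
      have "N (x + \<tau> *\<^sub>R y) \<le> 1 + \<tau>" "N (x + (- \<tau>) *\<^sub>R y) \<le> 1 + \<tau>"
        using equivalent_norm_basic(3)[OF N, of x "\<tau> *\<^sub>R y"]
          equivalent_norm_basic(3)[OF N, of x "(- \<tau>) *\<^sub>R y"] 2 tau
        unfolding equivalent_norm_basic(4)[OF N] by simp_all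
      then show ?thesis
        using 2(3) by (simp add: field_simps)
    qed (use tau in simp)
  qed
qed (use xy in blast)

text \<open>The modulus controls the second difference \<open>N (z + h) + N (z - h) - 2 * N z\<close> by
  \<open>2 * K * (N h)\<^sup>2 / N z\<close>. Multiplication by \<open>N z\<close>, which happens when one passes to the square
  of the norm, cancels the singularity at the origin.\<close>

lemma norm_square_second_difference:
  assumes N: "equivalent_norm N" and S: "smoothness_power_type N 2"
  obtains C where "C > 0"
    "\<And>z h. (N (z + h))\<^sup>2 + (N (z - h))\<^sup>2 \<le> 2 * (N z)\<^sup>2 + C * (N h)\<^sup>2"
proof -
  note N_props = equivalent_norm_basic[OF N]
  obtain K where K: "K > 0" and mod_le: "\<And>\<tau>. \<tau> \<ge> 0 \<Longrightarrow> modulus_of_smoothness N \<tau> \<le> K * \<tau> powr 2"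
    using S by (auto simp: smoothness_power_type_def)
  have "(N (z + h))\<^sup>2 + (N (z - h))\<^sup>2 \<le> 2 * (N z)\<^sup>2 + (4 * K + 2) * (N h)\<^sup>2" for z h
  proof (cases "z = 0 \<or> h = 0")
    case True
    then show ?thesis
      using N_props(5)[of 0 h] K by (auto simp: N_props(1) algebra_simps)
  next
    case False
    then have pos: "N z > 0" "N h > 0"
      using N_props(2,6) by (simp_all add: less_le)
    \<comment> \<open>Rescaling to unit vectors.\<close>
    define \<tau> where "\<tau> = N h / N z"
    have tau: "\<tau> > 0"
      using pos by (simp add: \<tau>_def)
    define x y where "x = (1 / N z) *\<^sub>R z" and "y = (1 / N h) *\<^sub>R h"
    have xy: "N x = 1" "N y = 1"
      using pos by (simp_all add: x_def y_def N_props(4))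
    have eqs: "x + \<tau> *\<^sub>R y = (1 / N z) *\<^sub>R (z + h)" "x - \<tau> *\<^sub>R y = (1 / N z) *\<^sub>R (z - h)"
      using pos by (simp_all add: x_def y_def \<tau>_def algebra_simps)
    have "(N (x + \<tau> *\<^sub>R y) + N (x - \<tau> *\<^sub>R y)) / 2 - 1 \<le> K * \<tau> powr 2"
      using second_difference_le_modulus[OF N _ xy, of \<tau>] mod_le[of \<tau>] tau by simp
    then have "(N (z + h) + N (z - h)) / N z \<le> 2 + 2 * (K * \<tau>\<^sup>2)"
      unfolding eqs N_props(4) using pos tau by (simp add: powr_numeral add_divide_distrib)
    then have "N (z + h) + N (z - h) \<le> (2 + 2 * (K * \<tau>\<^sup>2)) * N z"
      using pos by (simp add: pos_divide_le_eq)
    then have "(N (z + h) + N (z - h)) * N z \<le> (2 + 2 * (K * \<tau>\<^sup>2)) * N z * N z"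
      using pos by (intro mult_right_mono) auto
    also have "\<dots> = 2 * (N z)\<^sup>2 + 2 * K * (N h)\<^sup>2"
      using pos by (simp add: \<tau>_def power2_eq_square field_simps)
    finally have sum: "(N (z + h) + N (z - h)) * N z \<le> 2 * (N z)\<^sup>2 + 2 * K * (N h)\<^sup>2" .
    \<comment> \<open>The squares differ from their linearisations at \<open>N z\<close> by these squares.\<close>
    have dev: "(N k - N z)\<^sup>2 \<le> (N h)\<^sup>2" if "k = z + h \<or> k = z - h" for k
    proof (rule abs_le_square_iff[THEN iffD1])
      have "N k \<le> N z + N h" "N z \<le> N k + N h"
        using that N_props(3)[of z h] N_props(3)[of z "- h"] N_props(3)[of "z + h" "- h"]
          N_props(3)[of "z - h" h] N_props(4)[of "-1" h] by auto
      then show "\<bar>N k - N z\<bar> \<le> \<bar>N h\<bar>"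
        using pos by linarith
    qed
    have "(N (z + h))\<^sup>2 + (N (z - h))\<^sup>2 = 2 * ((N (z + h) + N (z - h)) * N z)
        + (N (z + h) - N z)\<^sup>2 + (N (z - h) - N z)\<^sup>2 - 2 * (N z)\<^sup>2"
      by (simp add: power2_eq_square algebra_simps)
    also have "\<dots> \<le> 2 * (N z)\<^sup>2 + (4 * K + 2) * (N h)\<^sup>2"
      using sum dev[of "z + h"] dev[of "z - h"] by (simp add: algebra_simps)
    finally show ?thesis .
  qed
  then show ?thesis
    using that[of "4 * K + 2"] K by simp
qed

lemma norm_convex_combination_square:
  fixes N :: "'a::real_normed_vector \<Rightarrow> real"
  assumes N: "equivalent_norm N" and t: "0 \<le> t" "t \<le> 1"
  shows "(N (t *\<^sub>R x + (1 - t) *\<^sub>R y))\<^sup>2 \<le> t * (N x)\<^sup>2 + (1 - t) * (N y)\<^sup>2"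
proof -
  note N_props = equivalent_norm_basic[OF N]
  have "N (t *\<^sub>R x + (1 - t) *\<^sub>R y) \<le> t * N x + (1 - t) * N y"
    using N_props(3)[of "t *\<^sub>R x" "(1 - t) *\<^sub>R y"] t by (simp add: N_props(4))
  then have "(N (t *\<^sub>R x + (1 - t) *\<^sub>R y))\<^sup>2 \<le> (t * N x + (1 - t) * N y)\<^sup>2"
    using N_props(2) by (intro power_mono) auto
  also have "\<dots> = t * (N x)\<^sup>2 + (1 - t) * (N y)\<^sup>2 - t * (1 - t) * (N x - N y)\<^sup>2"
    by (simp add: power2_eq_square algebra_simps)
  also have "\<dots> \<le> t * (N x)\<^sup>2 + (1 - t) * (N y)\<^sup>2"
    using t by simp
  finally show ?thesis .
qed

text \<open>Along a line the squared norm is convex, so it lies above a supporting line at \<open>z\<close>. The second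
  difference bound reflects this into an upper bound by the same line plus a parabola, and averaging
  the upper bounds at the two end points cancels the linear terms.\<close>

lemma norm_square_paraconcave:
  fixes N :: "'a::real_normed_vector \<Rightarrow> real"
  assumes N: "equivalent_norm N" and S: "smoothness_power_type N 2"
  obtains C where "C > 0" "paraconcave (\<lambda>h. C * (N h)\<^sup>2) (\<lambda>x. (N x)\<^sup>2)"
proof -
  obtain C where C: "C > 0" and
    second: "\<And>z h. (N (z + h))\<^sup>2 + (N (z - h))\<^sup>2 \<le> 2 * (N z)\<^sup>2 + C * (N h)\<^sup>2"
    using norm_square_second_difference[OF N S] by blast
  have "paraconcave (\<lambda>h. C * (N h)\<^sup>2) (\<lambda>x. (N x)\<^sup>2)"
    unfolding paraconvex_def
  proof (intro allI ballI)
    fix x y :: 'a and t :: real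
    assume t: "t \<in> {0..1}"
    define z where "z = t *\<^sub>R x + (1 - t) *\<^sub>R y"
    define k where "k = x - y"
    define g where "g = (\<lambda>s. (N (z + s *\<^sub>R k))\<^sup>2)"
    have "convex_on UNIV g"
    proof (rule convex_onI)
      fix r a b :: real
      assume r: "0 < r" "r < 1"
      have "(1 - r) *\<^sub>R (z + a *\<^sub>R k) + (1 - (1 - r)) *\<^sub>R (z + b *\<^sub>R k)
          = z + ((1 - r) *\<^sub>R a + r *\<^sub>R b) *\<^sub>R k"
        by (simp add: algebra_simps)
      then show "g ((1 - r) *\<^sub>R a + r *\<^sub>R b) \<le> (1 - r) * g a + r * g b"
        using norm_convex_combination_square[OF N, of "1 - r" "z + a *\<^sub>R k" "z + b *\<^sub>R k"] r
        by (simp add: g_def)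
    qed simp
    then obtain m where m: "\<And>s. g 0 + m * s \<le> g s"
      using convex_le_Inf_differential[of UNIV g 0] by fastforce
    have upper: "g s \<le> g 0 + m * s + C * s\<^sup>2 * (N k)\<^sup>2" for s
    proof -
      have "g s + g (- s) \<le> 2 * g 0 + C * s\<^sup>2 * (N k)\<^sup>2"
        using second[of z "s *\<^sub>R k"]
        by (simp add: g_def equivalent_norm_basic(4)[OF N] power_mult_distrib)
      then show ?thesis
        using m[of "- s"] by simp
    qed
    have ends: "z + (1 - t) *\<^sub>R k = x" "z + (- t) *\<^sub>R k = y"
      by (simp_all add: z_def k_def algebra_simps)
    have "t * g (1 - t) + (1 - t) * g (- t)
        \<le> t * (g 0 + m * (1 - t) + C * (1 - t)\<^sup>2 * (N k)\<^sup>2)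
          + (1 - t) * (g 0 + m * (- t) + C * (- t)\<^sup>2 * (N k)\<^sup>2)"
      using t by (intro add_mono mult_left_mono upper) auto
    also have "\<dots> = g 0 + t * (1 - t) * (C * (N k)\<^sup>2)"
      by (simp add: power2_eq_square algebra_simps)
    finally show "- (N (t *\<^sub>R x + (1 - t) *\<^sub>R y))\<^sup>2
        \<le> t * - (N x)\<^sup>2 + (1 - t) * - (N y)\<^sup>2 + t * (1 - t) * (C * (N (x - y))\<^sup>2)"
      unfolding g_def ends by (simp add: z_def k_def)
  qed
  with C show ?thesis
    using that by blast
qed

section \<open>The concave modulus and the model function\<close>

text \<open>For positive \<open>M\<close> this is concave and nondecreasing on \<open>{0..}\<close>, as an infimum of such functions. It
  is the largest
  modulus \<open>\<omega>\<close> with \<open>\<omega> t \<le> e + M e * t\<close> for every \<open>e > 0\<close>, which is the form in which the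
  smallness at 0 and the linear growth at infinity of the data appear together.\<close>

definition concave_modulus :: "(real \<Rightarrow> real) \<Rightarrow> real \<Rightarrow> real" where
  "concave_modulus M t = (INF e\<in>{0<..}. e + M e * t)"

context
  fixes M :: "real \<Rightarrow> real"
  assumes M: "\<And>e. 0 < e \<Longrightarrow> 0 < M e"
begin

lemma concave_modulus_le:
  assumes "0 \<le> t" "0 < e"
  shows "concave_modulus M t \<le> e + M e * t"
  unfolding concave_modulus_def
proof (rule cINF_lower)
  show "bdd_below ((\<lambda>e. e + M e * t) ` {0<..})"
  proof (rule bdd_belowI2)
    show "0 \<le> e + M e * t" if "e \<in> {0<..}" for e
      using M[of e] that assms by simp
  qed
qed (use assms in simp)

lemma le_concave_modulus:
  assumes "\<And>e. 0 < e \<Longrightarrow> a \<le> e + M e * t"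
  shows "a \<le> concave_modulus M t"
  unfolding concave_modulus_def by (rule cINF_greatest) (use assms in auto)

lemma le_mult_concave_modulus:
  assumes "0 \<le> b" and "\<And>e. 0 < e \<Longrightarrow> a \<le> b * (e + M e * t)"
  shows "a \<le> b * concave_modulus M t"
proof (cases "b = 0")
  case False
  then have b: "b > 0"
    using assms(1) by simp
  have "a / b \<le> concave_modulus M t"
  proof (rule le_concave_modulus)
    fix e :: real
    assume "0 < e"
    from assms(2)[OF this] show "a / b \<le> e + M e * t"
      using b by (simp add: pos_divide_le_eq mult.commute)
  qed
  then show ?thesis
    using b by (simp add: pos_divide_le_eq mult.commute)
qed (use assms(2)[of 1] in simp)

lemma concave_modulus_nonneg: "0 \<le> t \<Longrightarrow> 0 \<le> concave_modulus M t"
  using M by (intro le_concave_modulus) (simp add: less_imp_le)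

lemma concave_modulus_mono:
  assumes "0 \<le> s" "s \<le> t"
  shows "concave_modulus M s \<le> concave_modulus M t"
proof (rule le_concave_modulus)
  fix e :: real
  assume e: "0 < e"
  have "concave_modulus M s \<le> e + M e * s"
    using concave_modulus_le assms e by simp
  also have "\<dots> \<le> e + M e * t"
    using M[OF e] assms by simp
  finally show "concave_modulus M s \<le> e + M e * t" .
qed

text \<open>Each quotient \<open>(e + M e * t) / t\<close> decreases in \<open>t\<close>, and so does that of the infimum by \<open>t\<close>. The
  form without division covers \<open>s = 0\<close>.\<close>

lemma concave_modulus_star_shaped:
  assumes "0 \<le> s" "s \<le> t"
  shows "s * concave_modulus M t \<le> t * concave_modulus M s"
proof (rule le_mult_concave_modulus)
  fix e :: real
  assume e: "0 < e"
  have "s * concave_modulus M t \<le> s * (e + M e * t)"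
    using assms e by (intro mult_left_mono concave_modulus_le) auto
  also have "\<dots> \<le> t * (e + M e * s)"
    using assms e by (simp add: algebra_simps)
  finally show "s * concave_modulus M t \<le> t * (e + M e * s)" .
qed (use assms in simp)

lemma concave_modulus_double: "0 \<le> t \<Longrightarrow> concave_modulus M (2 * t) \<le> 2 * concave_modulus M t"
  using concave_modulus_star_shaped[of t "2 * t"] by (cases "t = 0") (simp_all add: concave_modulus_nonneg)

text \<open>The slope of \<open>t * \<omega> t\<close> at \<open>t\<close> is at most \<open>2 * \<omega> t\<close> because \<open>\<omega> t / t\<close> decreases, and
  \<open>\<omega> (2 * h) \<le> 2 * \<omega> h\<close>.\<close>

lemma scaled_concave_modulus_increment:
  assumes "0 \<le> s" "0 \<le> r" "0 \<le> d" "0 \<le> h" "r \<le> s + d" "s + d \<le> 2 * h"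
  shows "r * concave_modulus M r - s * concave_modulus M s \<le> 4 * d * concave_modulus M h"
proof (cases "r \<le> s")
  case True
  have "r * concave_modulus M r \<le> s * concave_modulus M s"
    using True assms by (intro mult_mono concave_modulus_mono concave_modulus_nonneg) auto
  moreover have "0 \<le> 4 * d * concave_modulus M h"
    using assms concave_modulus_nonneg by simp
  ultimately show ?thesis by linarith
next
  case False
  have "concave_modulus M r \<le> 2 * concave_modulus M h"
    using concave_modulus_mono[of r "2 * h"] concave_modulus_double[of h] assms by linarith
  have "r * concave_modulus M r - s * concave_modulus M s
      = (r - s) * concave_modulus M r + (s * concave_modulus M r - s * concave_modulus M s)"
    by (simp add: algebra_simps)
  also have "\<dots> \<le> (r - s) * concave_modulus M r + (r - s) * concave_modulus M s"
    using concave_modulus_star_shaped[of s r] False assms by (simp add: algebra_simps)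
  also have "\<dots> \<le> (r - s) * concave_modulus M r + (r - s) * concave_modulus M r"
    using False assms by (intro add_left_mono mult_left_mono concave_modulus_mono) auto
  also have "\<dots> \<le> d * (2 * concave_modulus M h) + d * (2 * concave_modulus M h)"
    using False assms \<open>concave_modulus M r \<le> 2 * concave_modulus M h\<close>
    by (intro add_mono mult_mono concave_modulus_nonneg) auto
  finally show ?thesis by simp
qed

text \<open>The function \<open>\<psi> x = N x * \<omega> (N x)\<close> is, up to a constant, its own defect of concavity. On a segment
  of length \<open>h\<close> through a point \<open>z\<close> with \<open>N z \<le> h\<close>, where the norm may have a kink, it suffices
  that \<open>\<psi>\<close> is Lipschitz with a constant of order \<open>\<omega> h\<close>. If \<open>N z > h\<close>, the bound for the squared
  norm shows that the averages of \<open>N\<close> and of its square over the end points exceed \<open>N z\<close> and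
  \<open>(N z)\<^sup>2\<close> at most by a factor \<open>1 + \<kappa>\<close>, where \<open>\<kappa>\<close> has order \<open>t * (1 - t) * h\<^sup>2 / (N z)\<^sup>2\<close>. This
  is the same factor for all the functions \<open>e * N + M e * N\<^sup>2\<close>, so it passes to their infimum \<open>\<psi>\<close>;
  and \<open>\<kappa> * \<psi> z \<le> C * t * (1 - t) * h * \<omega> h\<close> because \<open>\<omega> t / t\<close> decreases.\<close>

lemma scaled_modulus_norm_paraconcave:
  fixes N :: "'a::real_normed_vector \<Rightarrow> real"
  assumes N: "equivalent_norm N" and C: "C > 0"
    and conc: "paraconcave (\<lambda>h. C * (N h)\<^sup>2) (\<lambda>x. (N x)\<^sup>2)"
  shows "paraconcave (\<lambda>h. (C + 8) * (N h * concave_modulus M (N h)))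
    (\<lambda>x. N x * concave_modulus M (N x))"
  unfolding paraconvex_def
proof (intro allI ballI)
  fix x y :: 'a and t :: real
  assume t: "t \<in> {0..1}"
  let ?\<omega> = "concave_modulus M"
  note N_props = equivalent_norm_basic[OF N]
  define z where "z = t *\<^sub>R x + (1 - t) *\<^sub>R y"
  define s h where "s = N z" and "h = N (x - y)"
  have nn: "0 \<le> s" "0 \<le> h" "0 \<le> N x" "0 \<le> N y" "0 \<le> ?\<omega> h"
    using N_props(2) by (simp_all add: s_def h_def concave_modulus_nonneg)
  have hw: "0 \<le> t * (1 - t) * (h * ?\<omega> h)"
    using t nn by simp
  have "t * (N x * ?\<omega> (N x)) + (1 - t) * (N y * ?\<omega> (N y)) - s * ?\<omega> s
      \<le> t * (1 - t) * ((C + 8) * (h * ?\<omega> h))"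
  proof (cases "s \<le> h")
    case True
    have "x = z + (1 - t) *\<^sub>R (x - y)" "y = z + t *\<^sub>R (y - x)"
      by (simp_all add: z_def algebra_simps)
    then have "N x \<le> s + (1 - t) * h" "N y \<le> s + t * h"
      using N_props(3)[of z "(1 - t) *\<^sub>R (x - y)"] N_props(3)[of z "t *\<^sub>R (y - x)"] t
        N_props(5)[of x y]
      by (simp_all add: N_props(4) s_def h_def)
    moreover have "(1 - t) * h \<le> h" "t * h \<le> h"
      using t nn by (simp_all add: mult_left_le_one_le)
    ultimately have "N x * ?\<omega> (N x) - s * ?\<omega> s \<le> 4 * ((1 - t) * h) * ?\<omega> h"
      "N y * ?\<omega> (N y) - s * ?\<omega> s \<le> 4 * (t * h) * ?\<omega> h"
      using t nn True by (auto intro!: scaled_concave_modulus_increment)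
    then have "t * (N x * ?\<omega> (N x) - s * ?\<omega> s) + (1 - t) * (N y * ?\<omega> (N y) - s * ?\<omega> s)
        \<le> t * (4 * ((1 - t) * h) * ?\<omega> h) + (1 - t) * (4 * (t * h) * ?\<omega> h)"
      using t by (intro add_mono mult_left_mono) auto
    then have "t * (N x * ?\<omega> (N x)) + (1 - t) * (N y * ?\<omega> (N y)) - s * ?\<omega> s
        \<le> 8 * (t * (1 - t) * (h * ?\<omega> h))"
      by (simp add: algebra_simps)
    moreover have "0 \<le> C * (t * (1 - t) * (h * ?\<omega> h))"
      using C hw by simp
    ultimately show ?thesis
      by (simp add: algebra_simps)
  next
    case False
    then have s: "s > 0"
      using nn by simp
    define \<kappa> where "\<kappa> = C * (t * (1 - t)) * h\<^sup>2 / s\<^sup>2"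
    have kappa: "0 \<le> \<kappa>"
      using C t by (simp add: \<kappa>_def)
    have "t * (N x)\<^sup>2 + (1 - t) * (N y)\<^sup>2 \<le> s\<^sup>2 + t * (1 - t) * (C * h\<^sup>2)"
      using paraconvexD[OF conc, of t x y] t by (simp add: s_def h_def z_def)
    also have "\<dots> = (1 + \<kappa>) * s\<^sup>2"
      using s by (simp add: \<kappa>_def field_simps)
    finally have sq: "t * (N x)\<^sup>2 + (1 - t) * (N y)\<^sup>2 \<le> (1 + \<kappa>) * s\<^sup>2" .
    have "t * N x + (1 - t) * N y \<le> (1 + \<kappa>) * s"
    proof (rule power2_le_imp_le)
      have "(t * N x + (1 - t) * N y)\<^sup>2
          = t * (N x)\<^sup>2 + (1 - t) * (N y)\<^sup>2 - t * (1 - t) * (N x - N y)\<^sup>2"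
        by (simp add: power2_eq_square algebra_simps)
      also have "\<dots> \<le> (1 + \<kappa>) * s\<^sup>2"
        using sq t by (smt (verit) atLeastAtMost_iff mult_nonneg_nonneg zero_le_power2)
      also have "\<dots> \<le> (1 + \<kappa>)\<^sup>2 * s\<^sup>2"
        using kappa by (intro mult_right_mono) (auto simp: power2_eq_square algebra_simps)
      finally show "(t * N x + (1 - t) * N y)\<^sup>2 \<le> ((1 + \<kappa>) * s)\<^sup>2"
        by (simp add: power_mult_distrib)
    qed (use kappa s in simp)
    note lin = this
    have "t * (N x * ?\<omega> (N x)) + (1 - t) * (N y * ?\<omega> (N y)) \<le> (1 + \<kappa>) * s * ?\<omega> s"
    proof (rule le_mult_concave_modulus)
      fix e :: real
      assume e: "0 < e"
      have "t * (N x * ?\<omega> (N x)) + (1 - t) * (N y * ?\<omega> (N y))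
          \<le> t * (N x * (e + M e * N x)) + (1 - t) * (N y * (e + M e * N y))"
        using t nn e by (intro add_mono mult_left_mono concave_modulus_le) auto
      also have "\<dots> = e * (t * N x + (1 - t) * N y) + M e * (t * (N x)\<^sup>2 + (1 - t) * (N y)\<^sup>2)"
        by (simp add: power2_eq_square algebra_simps)
      also have "\<dots> \<le> e * ((1 + \<kappa>) * s) + M e * ((1 + \<kappa>) * s\<^sup>2)"
        using e M[OF e] lin sq by (intro add_mono mult_left_mono) auto
      also have "\<dots> = (1 + \<kappa>) * s * (e + M e * s)"
        by (simp add: power2_eq_square algebra_simps)
      finally show "t * (N x * ?\<omega> (N x)) + (1 - t) * (N y * ?\<omega> (N y))
          \<le> (1 + \<kappa>) * s * (e + M e * s)" .
    qed (use kappa s in simp)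
    moreover have "\<kappa> * s * ?\<omega> s \<le> C * (t * (1 - t) * (h * ?\<omega> h))"
    proof -
      have "\<kappa> * s * ?\<omega> s = C * (t * (1 - t)) * h * (h * ?\<omega> s) / s"
        using s by (simp add: \<kappa>_def power2_eq_square)
      also have "\<dots> \<le> C * (t * (1 - t)) * h * (s * ?\<omega> h) / s"
        using C t nn s False concave_modulus_star_shaped[of h s]
        by (intro divide_right_mono mult_left_mono) auto
      also have "\<dots> = C * (t * (1 - t) * (h * ?\<omega> h))"
        using s by simp
      finally show ?thesis .
    qed
    ultimately show ?thesis
      using hw by (simp add: algebra_simps)
  qed
  then show "- (N (t *\<^sub>R x + (1 - t) *\<^sub>R y) * ?\<omega> (N (t *\<^sub>R x + (1 - t) *\<^sub>R y)))
      \<le> t * - (N x * ?\<omega> (N x)) + (1 - t) * - (N y * ?\<omega> (N y))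
        + t * (1 - t) * ((C + 8) * (N (x - y) * ?\<omega> (N (x - y))))"
    by (simp add: z_def s_def h_def)
qed

text \<open>The difference of the two affine functions at \<open>x\<close> is a Taylor remainder between \<open>y\<close> and \<open>z\<close> plus
  the change \<open>G z - G y\<close> applied to \<open>x - z\<close>. With \<open>m\<close> the larger of the distances of \<open>x\<close> from
  \<open>y\<close> and \<open>z\<close>, these are at most \<open>2 * m * \<omega> (2 * m)\<close> and \<open>m * \<omega> (2 * m)\<close>; as
  \<open>\<omega> (2 * m) \<le> 2 * \<omega> m\<close>, the sum is at most \<open>6 * m * \<omega> m\<close>, whence the factor 6.\<close>

lemma jet_minorant_le_majorant:
  fixes N :: "'a::real_normed_vector \<Rightarrow> real"
  assumes N: "equivalent_norm N"
    and G: "\<And>e x y h. 0 < e \<Longrightarrow> x \<in> E \<Longrightarrow> y \<in> E \<Longrightarrow>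
      \<bar>blinfun_apply (G y - G x) h\<bar> \<le> N h * (e + M e * N (y - x))"
    and f: "\<And>e x y. 0 < e \<Longrightarrow> x \<in> E \<Longrightarrow> y \<in> E \<Longrightarrow>
      \<bar>f y - f x - blinfun_apply (G x) (y - x)\<bar> \<le> N (y - x) * (e + M e * N (y - x))"
    and yz: "y \<in> E" "z \<in> E"
  shows "f y + blinfun_apply (G y) (x - y) - 6 * (N (x - y) * concave_modulus M (N (x - y)))
    \<le> f z + blinfun_apply (G z) (x - z) + 6 * (N (x - z) * concave_modulus M (N (x - z)))"
proof -
  let ?\<omega> = "concave_modulus M"
  note N_props = equivalent_norm_basic[OF N]
  define m where "m = max (N (x - y)) (N (x - z))"
  have m: "0 \<le> m" "N (x - y) \<le> m" "N (x - z) \<le> m"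
    using N_props(2)[of "x - y"] by (auto simp: m_def)
  have zy: "N (z - y) \<le> 2 * m"
    using N_props(3)[of "z - x" "x - y"] N_props(5)[of z x] m by simp
  have w: "0 \<le> ?\<omega> m" "0 \<le> ?\<omega> (N (z - y))" "?\<omega> (N (z - y)) \<le> 2 * ?\<omega> m"
    using concave_modulus_nonneg concave_modulus_mono[OF N_props(2) zy]
      concave_modulus_double[OF m(1)] m(1) N_props(2) by (auto intro: order_trans)
  have "\<bar>f z - f y - blinfun_apply (G y) (z - y)\<bar> \<le> N (z - y) * ?\<omega> (N (z - y))"
    using f[OF _ yz] by (intro le_mult_concave_modulus N_props(2))
  also have "\<dots> \<le> (2 * m) * (2 * ?\<omega> m)"
    using zy w m(1) N_props(2) by (intro mult_mono) auto
  finally have rem: "\<bar>f z - f y - blinfun_apply (G y) (z - y)\<bar> \<le> 4 * (m * ?\<omega> m)"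
    by simp
  have "\<bar>blinfun_apply (G z - G y) (x - z)\<bar> \<le> N (x - z) * ?\<omega> (N (z - y))"
    using G[OF _ yz] by (intro le_mult_concave_modulus N_props(2))
  also have "\<dots> \<le> m * (2 * ?\<omega> m)"
    using w m by (intro mult_mono) auto
  finally have slope: "\<bar>blinfun_apply (G z - G y) (x - z)\<bar> \<le> 2 * (m * ?\<omega> m)"
    by simp
  have "0 \<le> N k * ?\<omega> (N k)" for k
    using N_props(2) concave_modulus_nonneg by simp
  from this[of "x - y"] this[of "x - z"]
  have max_le: "m * ?\<omega> m \<le> N (x - y) * ?\<omega> (N (x - y)) + N (x - z) * ?\<omega> (N (x - z))"
    by (auto simp: m_def max_def)
  have "blinfun_apply (G y) (x - y) = blinfun_apply (G y) (x - z) + blinfun_apply (G y) (z - y)"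
    by (simp flip: blinfun.add_right)
  then have "f z + blinfun_apply (G z) (x - z) - (f y + blinfun_apply (G y) (x - y))
      = (f z - f y - blinfun_apply (G y) (z - y)) + blinfun_apply (G z - G y) (x - z)"
    by (simp add: blinfun.diff_left)
  then show ?thesis
    using rem slope max_le by linarith
qed

end

section \<open>Necessity\<close>

text \<open>A segment of length \<open>r\<close> splits into at most \<open>r / d + 1\<close> pieces shorter than \<open>d\<close>.\<close>

lemma linear_growth_if_unit_steps:
  fixes D :: "'a::real_normed_vector \<Rightarrow> 'b::real_normed_vector"
  assumes d: "0 < d" and step: "\<And>x y. norm (y - x) < d \<Longrightarrow> norm (D y - D x) \<le> 1"
  shows "norm (D y - D x) \<le> norm (y - x) / d + 1"
proof -
  have chain: "norm (D y - D x) \<le> real (Suc n)" if "norm (y - x) < real (Suc n) * d" for n y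
    using that
  proof (induction n arbitrary: y)
    case 0
    then show ?case
      using step[of y x] by simp
  next
    case (Suc n)
    \<comment> \<open>\<open>z\<close> cuts off the last of \<open>n + 2\<close> equal pieces.\<close>
    define c where "c = real (Suc n) / real (Suc (Suc n))"
    define z where "z = x + c *\<^sub>R (y - x)"
    have c: "0 < c" "c < 1"
      by (simp_all add: c_def)
    have "norm (z - x) = c * norm (y - x)"
      using c by (simp add: z_def)
    also have "\<dots> < c * (real (Suc (Suc n)) * d)"
      using c Suc.prems by (intro mult_strict_left_mono)
    also have "\<dots> = real (Suc n) * d"
      by (simp add: c_def)
    finally have "norm (D z - D x) \<le> real (Suc n)"
      by (rule Suc.IH)
    moreover have "norm (D y - D z) \<le> 1"
    proof (rule step)
      have "y - z = (1 - c) *\<^sub>R (y - x)"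
        by (simp add: z_def algebra_simps)
      then have "norm (y - z) = (1 - c) * norm (y - x)"
        using c by simp
      also have "\<dots> < (1 - c) * (real (Suc (Suc n)) * d)"
        using c Suc.prems by (intro mult_strict_left_mono) auto
      also have "\<dots> = d"
        by (simp add: c_def field_simps)
      finally show "norm (y - z) < d" .
    qed
    ultimately show ?case
      using norm_triangle_ineq[of "D y - D z" "D z - D x"] by simp
  qed
  define n where "n = nat \<lfloor>norm (y - x) / d\<rfloor>"
  have n: "real n \<le> norm (y - x) / d" "norm (y - x) / d < real (Suc n)"
    using d by (simp_all add: n_def) linarith
  then have "norm (y - x) < real (Suc n) * d"
    using d by (simp add: pos_divide_less_eq)
  from chain[OF this] n(1) show ?thesis
    by simp
qed

text \<open>The mean value inequality for \<open>F\<close> minus its linear part at \<open>x\<close>.\<close>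

lemma taylor_bound_frechet_D:
  assumes F: "F \<in> C1_plus UNIV"
    and B: "\<And>z. norm (z - x) \<le> norm (y - x) \<Longrightarrow> norm (frechet_D F z - frechet_D F x) \<le> B"
  shows "\<bar>F y - F x - blinfun_apply (frechet_D F x) (y - x)\<bar> \<le> B * norm (y - x)"
proof -
  define S where "S = cball x (norm (y - x))"
  have der: "(F has_derivative blinfun_apply (frechet_D F z)) (at z)" for z
  proof -
    obtain L where L: "(F has_derivative L) (at z)"
      using F by (auto simp: C1_plus_def differentiable_def)
    then show ?thesis
      using blinfun_apply_frechet_D[OF L] by simp
  qed
  have "norm (F y - F x - blinfun_apply (frechet_D F x) (y - x)) \<le> norm (y - x) * B"
  proof (rule differentiable_bound_linearization[where S = S])
    show "x + t *\<^sub>R (y - x) \<in> S" if "t \<in> {0..1}" for t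
      using that by (auto simp: S_def dist_norm mult_left_le_one_le)
    show "(F has_derivative blinfun_apply (frechet_D F z)) (at z within S)" for z
      using der has_derivative_at_withinI by blast
    show "onorm (blinfun_apply (frechet_D F z) - blinfun_apply (frechet_D F x)) \<le> B" if "z \<in> S" for z
      using B[of z] that
      by (simp add: S_def dist_norm norm_minus_commute norm_blinfun.rep_eq minus_blinfun.rep_eq fun_diff_def)
  qed (simp add: S_def)
  then show ?thesis
    by (simp add: mult.commute)
qed

lemma C1_plus_cond_W:
  assumes F: "F \<in> C1_plus UNIV" and f: "\<And>x. x \<in> E \<Longrightarrow> F x = f x"
  shows "cond_W E f (frechet_D F)"
  unfolding cond_W_def
proof (intro conjI allI impI)
  have uc: "uniformly_continuous_on UNIV (frechet_D F)"
    using F by (simp add: C1_plus_def)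
  then show "uniformly_continuous_on E (frechet_D F)"
    unfolding uniformly_continuous_on_def by (meson UNIV_I)
  fix e :: real
  assume e: "0 < e"
  obtain d where d: "d > 0" "\<And>x y. norm (y - x) < d \<Longrightarrow> norm (frechet_D F y - frechet_D F x) < e"
    using uc e unfolding uniformly_continuous_on_def dist_norm by auto
  show "\<exists>d>0. \<forall>x\<in>E. \<forall>y\<in>E. norm (y - x) < d \<longrightarrow>
      \<bar>f y - f x - blinfun_apply (frechet_D F x) (y - x)\<bar> \<le> e * norm (y - x)"
  proof (intro exI[of _ d] conjI d(1) ballI impI)
    fix x y
    assume xy: "x \<in> E" "y \<in> E" "norm (y - x) < d"
    have "norm (frechet_D F z - frechet_D F x) \<le> e" if "norm (z - x) \<le> norm (y - x)" for z
      using d(2)[of z x] that xy(3) by simp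
    from taylor_bound_frechet_D[OF F this, of y]
    show "\<bar>f y - f x - blinfun_apply (frechet_D F x) (y - x)\<bar> \<le> e * norm (y - x)"
      using f xy by simp
  qed
qed

lemma C1_plus_cond_large:
  assumes F: "F \<in> C1_plus UNIV" and f: "\<And>x. x \<in> E \<Longrightarrow> F x = f x"
  shows "cond_large E f (frechet_D F)"
  unfolding cond_large_def
proof (intro allI impI)
  fix d :: real
  assume d: "0 < d"
  have "uniformly_continuous_on UNIV (frechet_D F)"
    using F by (simp add: C1_plus_def)
  then obtain c where c: "c > 0" "\<And>x y. norm (y - x) < c \<Longrightarrow> norm (frechet_D F y - frechet_D F x) \<le> 1"
    unfolding uniformly_continuous_on_def dist_norm by (metis UNIV_I less_imp_le zero_less_one)
  have growth: "norm (frechet_D F y - frechet_D F x) \<le> norm (y - x) / c + 1" for x y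
    using linear_growth_if_unit_steps[of c "frechet_D F", OF c] .
  define K where "K = 1 / c + 1 / d"
  have far: "norm (frechet_D F z - frechet_D F x) \<le> K * norm (y - x)"
    if "d \<le> norm (y - x)" "norm (z - x) \<le> norm (y - x)" for x y z
  proof -
    have "norm (z - x) / c \<le> norm (y - x) / c" "1 \<le> norm (y - x) / d"
      using that c(1) d by (simp_all add: divide_right_mono)
    then show ?thesis
      using growth[of z x] by (simp add: K_def algebra_simps)
  qed
  show "\<exists>K>0. \<forall>x\<in>E. \<forall>y\<in>E. norm (y - x) \<ge> d \<longrightarrow>
      norm (frechet_D F y - frechet_D F x) \<le> K * norm (y - x) \<and>
      \<bar>f y - f x - blinfun_apply (frechet_D F x) (y - x)\<bar> \<le> K * (norm (y - x))\<^sup>2"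
  proof (intro exI[of _ K] conjI ballI impI)
    show "0 < K"
      using c(1) d by (simp add: K_def add_pos_pos)
    fix x y
    assume xy: "x \<in> E" "y \<in> E" "d \<le> norm (y - x)"
    show "norm (frechet_D F y - frechet_D F x) \<le> K * norm (y - x)"
      using far[OF xy(3)] by simp
    show "\<bar>f y - f x - blinfun_apply (frechet_D F x) (y - x)\<bar> \<le> K * (norm (y - x))\<^sup>2"
      using taylor_bound_frechet_D[OF F, of x y, OF far[OF xy(3)]] f xy(1,2)
      by (simp add: power2_eq_square mult.assoc)
  qed
qed

section \<open>Extension\<close>

text \<open>Joins the two conditions into one bound for all pairs of points: below the threshold \<open>d\<close> given by
  \<open>cond_W\<close> for \<open>e\<close>, the term with \<open>e\<close> suffices, and \<open>cond_large\<close> at distance \<open>d\<close>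
  covers the remaining pairs by the term with \<open>K\<close>.\<close>

lemma cond_W_cond_large_affine_bound:
  assumes W: "cond_W E f G" and large: "cond_large E f G" and e: "0 < e"
  obtains K where "K > 0" and "\<And>x y. x \<in> E \<Longrightarrow> y \<in> E \<Longrightarrow>
      norm (G y - G x) \<le> e + K * norm (y - x) \<and>
      \<bar>f y - f x - blinfun_apply (G x) (y - x)\<bar> \<le> (e + K * norm (y - x)) * norm (y - x)"
proof -
  have "uniformly_continuous_on E G"
    using W by (simp add: cond_W_def)
  then obtain d1 where d1: "d1 > 0"
    "\<And>x y. x \<in> E \<Longrightarrow> y \<in> E \<Longrightarrow> norm (y - x) < d1 \<Longrightarrow> norm (G y - G x) < e"
    using e unfolding uniformly_continuous_on_def dist_norm by metis
  obtain d2 where d2: "d2 > 0"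
    "\<And>x y. x \<in> E \<Longrightarrow> y \<in> E \<Longrightarrow> norm (y - x) < d2 \<Longrightarrow>
      \<bar>f y - f x - blinfun_apply (G x) (y - x)\<bar> \<le> e * norm (y - x)"
    using W e unfolding cond_W_def by metis
  define d where "d = min d1 d2"
  have "d > 0"
    using d1 d2 by (simp add: d_def)
  then obtain K where K: "K > 0"
    "\<And>x y. x \<in> E \<Longrightarrow> y \<in> E \<Longrightarrow> norm (y - x) \<ge> d \<Longrightarrow>
      norm (G y - G x) \<le> K * norm (y - x) \<and>
      \<bar>f y - f x - blinfun_apply (G x) (y - x)\<bar> \<le> K * (norm (y - x))\<^sup>2"
    using large unfolding cond_large_def by metis
  have "norm (G y - G x) \<le> e + K * norm (y - x) \<and>
      \<bar>f y - f x - blinfun_apply (G x) (y - x)\<bar> \<le> (e + K * norm (y - x)) * norm (y - x)"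
    if xy: "x \<in> E" "y \<in> E" for x y
  proof (cases "norm (y - x) < d")
    case True
    then have close: "norm (G y - G x) < e"
      "\<bar>f y - f x - blinfun_apply (G x) (y - x)\<bar> \<le> e * norm (y - x)"
      using d1(2)[OF xy] d2(2)[OF xy] by (auto simp: d_def)
    have "0 \<le> K * norm (y - x)"
      using K(1) by simp
    moreover from this have "e * norm (y - x) \<le> (e + K * norm (y - x)) * norm (y - x)"
      by (intro mult_right_mono) auto
    ultimately show ?thesis
      using close by linarith
  next
    case False
    then have "norm (G y - G x) \<le> K * norm (y - x)"
      "\<bar>f y - f x - blinfun_apply (G x) (y - x)\<bar> \<le> (K * norm (y - x)) * norm (y - x)"
      using K(2)[OF xy] by (simp_all add: power2_eq_square mult.assoc)
    moreover have "(K * norm (y - x)) * norm (y - x) \<le> (e + K * norm (y - x)) * norm (y - x)"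
      using e by (intro mult_right_mono) auto
    ultimately show ?thesis
      using e by linarith
  qed
  with K(1) that show ?thesis
    by blast
qed

text \<open>Passing from the given norm to \<open>N\<close> costs constant factors, which are harmless as \<open>e\<close> is
  arbitrary: the bound for \<open>a * e\<close> in the given norm yields the one for \<open>e\<close> in \<open>N\<close>.\<close>

lemma jet_affine_bound_equivalent_norm:
  fixes N :: "'a::real_normed_vector \<Rightarrow> real"
  assumes N: "equivalent_norm N" and W: "cond_W E f G" and large: "cond_large E f G"
  obtains M :: "real \<Rightarrow> real" where "\<And>e. 0 < e \<Longrightarrow> 0 < M e"
    and "\<And>e x y h. 0 < e \<Longrightarrow> x \<in> E \<Longrightarrow> y \<in> E \<Longrightarrow>
      \<bar>blinfun_apply (G y - G x) h\<bar> \<le> N h * (e + M e * N (y - x))"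
    and "\<And>e x y. 0 < e \<Longrightarrow> x \<in> E \<Longrightarrow> y \<in> E \<Longrightarrow>
      \<bar>f y - f x - blinfun_apply (G x) (y - x)\<bar> \<le> N (y - x) * (e + M e * N (y - x))"
proof -
  obtain a where a: "a > 0" "\<And>x. a * norm x \<le> N x"
    using N by (auto simp: equivalent_norm_def)
  have norm_le: "norm x \<le> N x / a" for x
    using a by (simp add: pos_le_divide_eq mult.commute)
  have "\<forall>e. \<exists>m. 0 < e \<longrightarrow> 0 < m \<and> (\<forall>x\<in>E. \<forall>y\<in>E.
      (\<forall>h. \<bar>blinfun_apply (G y - G x) h\<bar> \<le> N h * (e + m * N (y - x))) \<and>
      \<bar>f y - f x - blinfun_apply (G x) (y - x)\<bar> \<le> N (y - x) * (e + m * N (y - x)))"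
    (is "\<forall>e. \<exists>m. ?P e m")
  proof
    fix e :: real
    show "\<exists>m. ?P e m"
    proof (cases "0 < e")
      case True
      then have "0 < a * e"
        using a by simp
      then obtain K where K: "K > 0" "\<And>x y. x \<in> E \<Longrightarrow> y \<in> E \<Longrightarrow>
          norm (G y - G x) \<le> a * e + K * norm (y - x) \<and>
          \<bar>f y - f x - blinfun_apply (G x) (y - x)\<bar> \<le> (a * e + K * norm (y - x)) * norm (y - x)"
        using cond_W_cond_large_affine_bound[OF W large] by metis
      have scaled: "(a * e + K * norm k) * norm h \<le> N h * (e + K / a\<^sup>2 * N k)" for h k
      proof -
        have "K * norm k \<le> K * (N k / a)"
          using K(1) by (intro mult_left_mono norm_le) simp
        then have "(a * e + K * norm k) * norm h \<le> (a * e + K * (N k / a)) * (N h / a)"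
          using norm_le[of h] True a K(1) equivalent_norm_basic(2)[OF N]
          by (intro mult_mono) (auto intro!: add_nonneg_nonneg)
        also have "\<dots> = N h * (e + K / a\<^sup>2 * N k)"
          using a(1) by (simp add: power2_eq_square field_simps)
        finally show ?thesis .
      qed
      have "?P e (K / a\<^sup>2)"
      proof (intro impI conjI ballI allI)
        fix x y h
        assume xy: "x \<in> E" "y \<in> E"
        have "\<bar>blinfun_apply (G y - G x) h\<bar> \<le> norm (G y - G x) * norm h"
          using norm_blinfun[of "G y - G x" h] by simp
        also have "\<dots> \<le> (a * e + K * norm (y - x)) * norm h"
          using K(2)[OF xy] by (intro mult_right_mono) auto
        also note scaled
        finally show "\<bar>blinfun_apply (G y - G x) h\<bar> \<le> N h * (e + K / a\<^sup>2 * N (y - x))" .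
        show "\<bar>f y - f x - blinfun_apply (G x) (y - x)\<bar> \<le> N (y - x) * (e + K / a\<^sup>2 * N (y - x))"
          using K(2)[OF xy] scaled[of "y - x" "y - x"] by linarith
      qed (use K(1) a(1) in simp)
      then show ?thesis ..
    qed simp
  qed
  from choice[OF this] obtain M where M: "\<And>e. ?P e (M e)"
    by blast
  show ?thesis
    by (rule that[of M]) (use M in \<open>simp_all only:\<close>)
qed

lemma paraconvex_affine_plus:
  fixes L :: "'a::real_normed_vector \<Rightarrow>\<^sub>L real"
  assumes w: "paraconvex q w" and c: "0 \<le> c"
  shows "paraconvex (\<lambda>h. c * q h) (\<lambda>x. b + blinfun_apply L (x - y) + c * w (x - y))"
  unfolding paraconvex_def
proof (intro allI ballI)
  fix u v :: 'a and t :: real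
  assume t: "t \<in> {0..1}"
  have shift: "t *\<^sub>R u + (1 - t) *\<^sub>R v - y = t *\<^sub>R (u - y) + (1 - t) *\<^sub>R (v - y)"
    by (simp add: algebra_simps)
  have "c * w (t *\<^sub>R (u - y) + (1 - t) *\<^sub>R (v - y))
      \<le> c * (t * w (u - y) + (1 - t) * w (v - y) + t * (1 - t) * q (u - v))"
    using paraconvexD[OF w, of t "u - y" "v - y"] t c by (intro mult_left_mono) auto
  then show "b + blinfun_apply L (t *\<^sub>R u + (1 - t) *\<^sub>R v - y)
        + c * w (t *\<^sub>R u + (1 - t) *\<^sub>R v - y)
      \<le> t * (b + blinfun_apply L (u - y) + c * w (u - y))
        + (1 - t) * (b + blinfun_apply L (v - y) + c * w (v - y)) + t * (1 - t) * (c * q (u - v))"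
    unfolding shift blinfun.add_right blinfun.scaleR_right by (simp add: algebra_simps)
qed

text \<open>The functions \<open>lower y\<close> and \<open>upper y\<close> touch at \<open>y\<close>, with value \<open>f y\<close> and slope \<open>G y\<close>.
  So whatever the insertion lemma puts between the two families has the prescribed value and
  derivative at each point of \<open>E\<close>.\<close>

theorem C1_plus_extension:
  fixes E :: "'a::real_normed_vector set" and f N :: "'a \<Rightarrow> real"
  assumes N: "equivalent_norm N" and S: "smoothness_power_type N 2"
    and W: "cond_W E f G" and large: "cond_large E f G"
  shows "\<exists>F\<in>C1_plus UNIV. (\<forall>x\<in>E. F x = f x) \<and> (\<forall>x\<in>E. frechet_D F x = G x)"
proof (cases "E = {}")
  case True
  have "((\<lambda>x::'a. 0::real) has_derivative (\<lambda>h. 0)) (at x)" for x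
    by simp
  then have "(\<lambda>x::'a. 0) \<in> C1_plus UNIV"
    by (rule C1_plus_if_uniform_expansion[where p = "\<lambda>h. 0"]) (auto intro!: exI[of _ 1])
  then show ?thesis
    using True by auto
next
  case False
  note N_props = equivalent_norm_basic[OF N]
  obtain M where M: "\<And>e. 0 < e \<Longrightarrow> 0 < M e" and
    jet: "\<And>e x y h. 0 < e \<Longrightarrow> x \<in> E \<Longrightarrow> y \<in> E \<Longrightarrow>
      \<bar>blinfun_apply (G y - G x) h\<bar> \<le> N h * (e + M e * N (y - x))"
    "\<And>e x y. 0 < e \<Longrightarrow> x \<in> E \<Longrightarrow> y \<in> E \<Longrightarrow>
      \<bar>f y - f x - blinfun_apply (G x) (y - x)\<bar> \<le> N (y - x) * (e + M e * N (y - x))"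
    using jet_affine_bound_equivalent_norm[OF N W large] by metis
  obtain C where C: "C > 0" and sq: "paraconcave (\<lambda>h. C * (N h)\<^sup>2) (\<lambda>x. (N x)\<^sup>2)"
    using norm_square_paraconcave[OF N S] by blast
  obtain b where b: "b > 0" "\<And>x. N x \<le> b * norm x"
    using N by (auto simp: equivalent_norm_def)
  define \<psi> where "\<psi> = (\<lambda>h. N h * concave_modulus M (N h))"
  define p where "p = (\<lambda>h. 6 * ((C + 8) * \<psi> h))"
  have \<psi>: "paraconcave (\<lambda>h. (C + 8) * \<psi> h) \<psi>"
    unfolding \<psi>_def by (rule scaled_modulus_norm_paraconcave[of M, OF M N C sq])
  have \<psi>_nonneg: "0 \<le> \<psi> h" for h
    using N_props(2) concave_modulus_nonneg[of M, OF M] by (simp add: \<psi>_def)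
  have \<psi>_le: "\<psi> h \<le> b * norm h * (e + M e * (b * norm h))" if e: "0 < e" for e h
  proof -
    have "concave_modulus M (N h) \<le> e + M e * (b * norm h)"
      using concave_modulus_le[of M, OF M N_props(2) e, of h] b(2)[of h] M[OF e]
      by (smt (verit) mult_left_mono)
    then show ?thesis
      unfolding \<psi>_def using b N_props(2) concave_modulus_nonneg[of M, OF M N_props(2)]
      by (intro mult_mono) auto
  qed
  have \<psi>_small: "\<exists>d>0. \<forall>h. norm h < d \<longrightarrow> c * \<psi> h \<le> e * norm h" if c: "0 < c" and e: "0 < e" for c e
  proof -
    \<comment> \<open>Below \<open>d\<close> both terms of the affine bound for \<open>e'\<close> are at most \<open>e'\<close>.\<close>
    define e' where "e' = e / (2 * c * b)"
    define d where "d = e' / (M e' * b)"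
    have e': "e' > 0"
      using b c e by (simp add: e'_def)
    have d: "d > 0"
      using b M[OF e'] e' by (simp add: d_def)
    have "c * \<psi> h \<le> e * norm h" if h: "norm h < d" for h
    proof -
      have "M e' * (b * norm h) \<le> M e' * (b * d)"
        using h b M[OF e'] by simp
      also have "\<dots> = e'"
        using b M[OF e'] by (simp add: d_def)
      finally have "b * norm h * (e' + M e' * (b * norm h)) \<le> b * norm h * (2 * e')"
        using b by (intro mult_left_mono) auto
      then have "c * \<psi> h \<le> c * (b * norm h * (2 * e'))"
        using \<psi>_le[OF e', of h] c by (intro mult_left_mono) auto
      also have "\<dots> = e * norm h"
        using b c by (simp add: e'_def)
      finally show ?thesis .
    qed
    with d show ?thesis by blast
  qed
  define lower upper where
    "lower = (\<lambda>y x. f y + blinfun_apply (G y) (x - y) - 6 * \<psi> (x - y))" and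
    "upper = (\<lambda>y x. f y + blinfun_apply (G y) (x - y) + 6 * \<psi> (x - y))"
  have lower_cvx: "paraconvex p (lower y)" for y
    using paraconvex_affine_plus[OF \<psi>, of 6 "f y" "G y" y] by (simp add: p_def lower_def)
  have upper_ccv: "paraconcave p (upper y)" for y
    using paraconvex_affine_plus[OF \<psi>, of 6 "- f y" "- G y" y]
    by (simp add: p_def upper_def blinfun.minus_left)
  have ordered: "lower y x \<le> upper z x" if "y \<in> E" "z \<in> E" for x y z
    using jet_minorant_le_majorant[of M, OF M N jet that] by (simp add: lower_def upper_def \<psi>_def)
  obtain F where F: "paraconvex p F" "paraconcave p F"
    and below: "\<And>y x. y \<in> E \<Longrightarrow> lower y x \<le> F x" and above: "\<And>y x. y \<in> E \<Longrightarrow> F x \<le> upper y x"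
  proof (rule paraconvex_insertion[of "lower ` E" "upper ` E" p])
    show "lower ` E \<noteq> {}" "upper ` E \<noteq> {}"
      using False by auto
    show "paraconvex p a" if "a \<in> lower ` E" for a
      using that lower_cvx by auto
    show "paraconcave p b" if "b \<in> upper ` E" for b
      using that upper_ccv by auto
    show "a x \<le> b x" if "a \<in> lower ` E" "b \<in> upper ` E" for a b x
      using that ordered by auto
  qed (rule that; blast)
  have near: "\<bar>F (y + h) - f y - blinfun_apply (G y) h\<bar> \<le> 6 * \<psi> h" if "y \<in> E" for y h
    using below[OF that, of "y + h"] above[OF that, of "y + h"] by (simp add: lower_def upper_def)
  have p_small: "\<exists>d>0. \<forall>h. norm h < d \<longrightarrow> p h \<le> e * norm h" if "0 < e" for e
  proof -
    have "0 < 6 * (C + 8)"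
      using C by simp
    from \<psi>_small[OF this that] show ?thesis
      unfolding p_def by (simp only: mult.assoc)
  qed
  have bounded: "\<exists>r>0. \<exists>B. \<forall>h. norm h < r \<longrightarrow> \<bar>F (x + h)\<bar> \<le> B" for x
  proof -
    obtain y where y: "y \<in> E"
      using False by blast
    define R where "R = norm (x - y) + 1"
    have "\<bar>F (x + h)\<bar> \<le> \<bar>f y\<bar> + norm (G y) * R + 6 * (b * R * (1 + M 1 * (b * R)))"
      if h: "norm h < 1" for h
    proof -
      define k where "k = x + h - y"
      have k: "norm k \<le> R"
        using norm_triangle_ineq[of "x - y" h] h by (simp add: k_def R_def algebra_simps)
      have R: "0 \<le> R"
        by (simp add: R_def)
      have "\<psi> k \<le> b * norm k * (1 + M 1 * (b * norm k))"
        using \<psi>_le[of 1] by simp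
      also have "\<dots> \<le> b * R * (1 + M 1 * (b * R))"
        using k b M[of 1] R by (intro mult_mono add_mono) (auto intro!: add_nonneg_nonneg mult_nonneg_nonneg)
      finally have "\<psi> k \<le> b * R * (1 + M 1 * (b * R))" .
      moreover have "\<bar>blinfun_apply (G y) k\<bar> \<le> norm (G y) * R"
        using norm_blinfun[of "G y" k] mult_left_mono[OF k norm_ge_zero[of "G y"]] by simp
      moreover have "\<bar>F (x + h) - f y - blinfun_apply (G y) k\<bar> \<le> 6 * \<psi> k"
        using near[OF y, of k] by (simp add: k_def)
      ultimately show ?thesis
        by linarith
    qed
    then show ?thesis
      using zero_less_one by blast
  qed
  have "F \<in> C1_plus UNIV"
    by (rule paraconvex_paraconcave_C1_plus[OF F p_small bounded])
  moreover have F_f: "F y = f y" if "y \<in> E" for y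
    using near[OF that, of 0] by (simp add: \<psi>_def N_props(1))
  moreover have "frechet_D F y = G y" if y: "y \<in> E" for y
  proof -
    have "(F has_derivative blinfun_apply (G y)) (at y)"
    proof (rule has_derivative_if_little_o[OF blinfun.bounded_linear_right])
      fix e :: real
      assume "0 < e"
      then obtain d where "d > 0" "\<And>h. norm h < d \<Longrightarrow> 6 * \<psi> h \<le> e * norm h"
        using \<psi>_small[of 6 e] by auto
      then show "\<exists>d>0. \<forall>h. norm h < d \<longrightarrow> \<bar>F (y + h) - F y - blinfun_apply (G y) h\<bar> \<le> e * norm h"
        using near[OF y] F_f[OF y] by (metis order_trans)
    qed
    then show ?thesis
      by (simp add: blinfun_apply_frechet_D blinfun_eqI)
  qed
  ultimately show ?thesis
    by blast
qed

theorem theorem52: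
  fixes E :: "'a::real_normed_vector set" and f :: "'a \<Rightarrow> real"
  shows
    "((\<exists>F\<in>C1_plus UNIV. \<forall>x\<in>E. F x = f x) \<longrightarrow>
        (\<exists>G. cond_W E f G \<and> cond_large E f G)) \<and>
     (complete (UNIV :: 'a set) \<and> super_reflexive TYPE('a) \<and>
      (\<exists>N :: 'a \<Rightarrow> real. equivalent_norm N \<and> smoothness_power_type N 2) \<longrightarrow>
        ((\<exists>F\<in>C1_plus UNIV. \<forall>x\<in>E. F x = f x) \<longleftrightarrow>
          (\<exists>G. cond_W E f G \<and> cond_large E f G)) \<and>
        (\<forall>G. cond_W E f G \<and> cond_large E f G \<longrightarrow>
          (\<exists>F\<in>C1_plus UNIV. (\<forall>x\<in>E. F x = f x) \<and> (\<forall>x\<in>E. frechet_D F x = G x))))"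
proof -
  have "\<exists>G. cond_W E f G \<and> cond_large E f G" if "\<exists>F\<in>C1_plus UNIV. \<forall>x\<in>E. F x = f x"
    using that C1_plus_cond_W C1_plus_cond_large by blast
  moreover have "\<exists>F\<in>C1_plus UNIV. (\<forall>x\<in>E. F x = f x) \<and> (\<forall>x\<in>E. frechet_D F x = G x)"
    if "equivalent_norm N" "smoothness_power_type N 2" "cond_W E f G" "cond_large E f G"
    for N :: "'a \<Rightarrow> real" and G
    using C1_plus_extension[OF that] .
  ultimately show ?thesis
    by blast
qed

end
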